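(* Let $F\subset\mathbb R^d$ be a solid set. Let $\mathbb P$ be a measure on $\mathbb R^d$ with density $f\ge 0$ with respect to $\mu_d$, and suppose there are bounded measurable functions $\bar f_+\ge0$, $\bar f_-\ge0$ on $\partial F$ such that, as $\varepsilon\to0^+$, $$\frac1\varepsilon\int_{\mathbb R^d}\mathbf 1\{0<d_F(z)\le\varepsilon\}\,|f(z)-\bar f_+(p_F(z))|\,\mu_d(dz)\to0,\qquad \frac1\varepsilon\int_{\mathbb R^d}\mathbf 1\{0<d_{F^*}(z)\le\varepsilon\}\,|f(z)-\bar f_-(p_{F^*}(z))|\,\mu_d(dz)\to0 .$$ Suppose that the functions $(x,u)\mapsto\bar f_\pm(x)$ are integrable with respect to $|\Theta_i|(F,\cdot)$ on $\mathrm{Nor}_e(F)$ for $i=0,\dots,d-1$. Define the measure $\mathbb Q$ on $\Sigma$ by $\mathbb Q(d(s,x,u))=ds\times\bar f_+(x)\,\Theta_{d-1}(F,d(x,u))$ on $\Sigma^+=\{s\ge0\}$ and $\mathbb Q(d(s,x,u))=ds\times\bar f_-(x)\,\Theta_{d-1}(F,d(x,u))$ on $\Sigma^-=\{s<0\}$. Let $T>0$ and let $A(\varepsilon)$, $0\le\varepsilon\le1$, be Borel sets with $A(0)\subset\partial F$ and $A(\varepsilon)\subset(\partial F)_{\varepsilon T}$, which are differentiable at $\partial F$ with a derivative $B\subset\Sigma_T$. Then $\lim_{\varepsilon\to0^+}\frac{\mathbb P(A(\varepsilon))-\mathbb P(A(0))}{\varepsilon}$ exists and equals $\mathbb Q(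B)$.
   Context: Notation: $\mu_d$ is Lebesgue measure on $\mathbb R^d$, $\mu_1$ Lebesgue measure on $\mathbb R$, $\mathcal H^{d-1}$ the $(d-1)$-dimensional Hausdorff measure, $S^{d-1}$ the unit sphere, $a\wedge b=\min(a,b)$. For a nonempty closed set $G\subset\mathbb R^d$ and $z\in\mathbb R^d$: $d_G(z)=\min_{x\in G}\|z-x\|$; the skeleton $S_G$ is the set of points having more than one nearest point in $G$; for $z\notin S_G$, $p_G(z)$ is the unique nearest point; for $z\notin S_G\cup G$, $u_G(z)=(z-p_G(z))/d_G(z)$. The normal bundle is $\mathrm{Nor}(G)=\{(p_G(z),u_G(z)):z\in\mathbb R^d\setminus(S_G\cup G)\}\subset\partial G\times S^{d-1}$, $N_G(x)=\{u:(x,u)\in\mathrm{Nor}(G)\}$, and the reach function is $r_G(x,u)=\sup\{s>0:p_G(x+su)=x\}\in(0,\infty]$. For $\varepsilon>0$, $G_\varepsilon=\{z:d_G(z)\le\varepsilon\}$. A point $x\in\partial G$ is regular if $N_G(x)$ is a single vector or a pair $\{u,-u\}$; $\mathrm{reg}(G)$ denotes the set of regular points. Support measures (Hug–Last–Weil local Steiner formula): there are uniquely determined set functions $\Theta_0(G,\cdot),\dots,\Theta_{d-1}(G,\cdot)$, defined on Borel sets $A\subset\mathrm{Nor}(G)$ contained in some $\{(x,u):\max(\|x\|,r_G(x,u)^{-1})\le c\}$, $c<\infty$, which are signed measures of finite variation on each such sublevel set, whose total variation measures $|\Theta_i|(G,\cdot)$ (extended to all Borel subsets of $\mathrm{Nor}(G)$)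 satisfy $\int\mathbf 1_K(x)(r_G(x,u)\wedge c)^{d-i}|\Theta_i|(G,d(x,u))<\infty$ for all compact $K$ and $c>0$, and such that for every bounded measurable $f$ with compact support $\int_{\mathbb R^d\setminus G}f\,d\mu_d=\sum_{j=1}^d\binom{d-1}{j-1}\int_{\mathrm{Nor}(G)}\int_0^{r_G(x,u)}f(x+tu)t^{j-1}\,dt\,\Theta_{d-j}(G,d(x,u))$. $\Theta_{d-1}(G,\cdot)$ is a nonnegative $\sigma$-finite measure. Solid sets: $F\subset\mathbb R^d$ is solid if it is compact, equals the closure of its interior, and $\mu_d(\partial F)=0$. Let $F^*$ be the closure of $\mathbb R^d\setminus F$, $R(x,u)=(x,-u)$, and $\mathrm{Nor}_e(F)=\mathrm{Nor}(F)\cup R(\mathrm{Nor}(F^* ))$. Outer reach: $r_+(x,u)=r_F(x,u)$ for $(x,u)\in\mathrm{Nor}(F)$, $r_+=0$ otherwise on $\mathrm{Nor}_e(F)$; inner reach: $r_-(x,u)=r_{F^*}(x,-u)$ for $(x,u)\in R(\mathrm{Nor}(F^* ))$, $r_-=0$ otherwise. The support measures of $F$ are extended to $\mathrm{Nor}_e(F)$ by $\Theta_i(F,A)=(-1)^{d-1-i}\Theta_i(F^*,R(A))$ for $A\subset R(\mathrm{Nor}(F^* ))$ (consistent on the overlap); $|\Theta_i|(F,\cdot)$ denotes the total variation on $\mathrm{Nor}_e(F)$. Moreover $\Theta_{d-1}(F,\cdot)=\int_{\mathrm{reg}(F)\cup\mathrm{reg}(F^* )}\mathbf 1\{(x,\nu(F,x))\in\cdot\}\,\mathcal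 H^{d-1}(dx)$, where $\nu(F,x)$ is the unique $u$ with $(x,u)\in\mathrm{Nor}_e(F)$. Normal cylinder: $\Sigma=\mathbb R\times\mathrm{Nor}_e(F)$, $M=\mu_1\otimes\Theta_{d-1}(F,\cdot)$; for $C\subset\Sigma$, $C^+=\{(t,x,u)\in C:t\ge0\}$, $C^-=\{(t,x,u)\in C:t<0\}$; $\Sigma_T=\{(t,x,u)\in\Sigma:|t|\le T\}$. Local magnification map ($\varepsilon>0$): $\tau_\varepsilon(z)=(d_F(z)/\varepsilon,p_F(z),u_F(z))$ for $z\notin F\cup S_F$, and $\tau_\varepsilon(z)=(-d_{F^*}(z)/\varepsilon,p_{F^*}(z),-u_{F^*}(z))$ for $z\notin F^*\cup S_{F^*}$; for Borel $A$, $\tau_\varepsilon(A)=\{\tau_\varepsilon(z):z\in A,\ z\notin\partial F\cup S_F\cup S_{F^*}\}$. A family $A(\varepsilon)$, $0\le\varepsilon\le1$, of bounded Borel sets with $A(0)\subset\partial F$ is essentially bounded (with bound $T>0$) if $\varepsilon^{-1}\mu_d(A(\varepsilon)\setminus(\partial F)_{\varepsilon T})\to0$ as $\varepsilon\to0^+$; it is differentiable at $\partial F$ with derivative $B$ (a Borel subset of $\Sigma$) if it is essentially bounded and $M(\tau_\varepsilon(A(\varepsilon))\triangle B)\to0$ as $\varepsilon\to0^+$. A family $F(\varepsilon)$, $0\le\varepsilon\le1$, of bounded Borel sets with $F(0)=F$ is differentiable at $F$ with derivative $B$ if $F(\varepsilon)\triangle F$ is differentiable at $\partial F$ with derivative $B$.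 *)

theory Defs
  imports "HOL-Analysis.Analysis"
begin

definition dist_set :: "'a::euclidean_space set \<Rightarrow> 'a \<Rightarrow> real" where
  "dist_set G z = infdist z G"

definition skeleton :: "'a::euclidean_space set \<Rightarrow> 'a set" where
  "skeleton G = {z. \<exists>x y. x \<in> G \<and> y \<in> G \<and> x \<noteq> y \<and>
      dist z x = infdist z G \<and> dist z y = infdist z G}"

text \<open>Metric projection p_G (meaningful for z outside the skeleton).\<close>
definition proj :: "'a::euclidean_space set \<Rightarrow> 'a \<Rightarrow> 'a" where
  "proj G z = (THE x. x \<in> G \<and> dist z x = infdist z G)"

text \<open>Unit vector u_G (meaningful for z outside skeleton and G).\<close>
definition unitn :: "'a::euclidean_space set \<Rightarrow> 'a \<Rightarrow> 'a" where
  "unitn G z = (1 / dist_set G z) *\<^sub>R (z - proj G z)"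

definition Nor :: "'a::euclidean_space set \<Rightarrow> ('a \<times> 'a) set" where
  "Nor G = {(proj G z, unitn G z) | z. z \<notin> skeleton G \<union> G}"

definition reach :: "'a::euclidean_space set \<Rightarrow> 'a \<Rightarrow> 'a \<Rightarrow> ereal" where
  "reach G x u = Sup (ereal ` {s. s > 0 \<and> x + s *\<^sub>R u \<notin> skeleton G \<and>
                                   proj G (x + s *\<^sub>R u) = x})"

definition parset :: "'a::euclidean_space set \<Rightarrow> real \<Rightarrow> 'a set" where
  "parset G e = {z. dist_set G z \<le> e}"

section \<open>Support measures (Hug--Last--Weil local Steiner formula)\<close>

text \<open>Each signed support measure Theta_i(G,.) is represented by its Jordan decomposition
  (Tp i, Tm i): two mutually singular nonnegative Borel measures on R^d x R^d, concentrated
  on Nor(G); the total variation |Theta_i(G,.)| is Tp i + Tm i.  The predicate states exactly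
  the defining properties of the support measures from the context (finiteness condition,
  local Steiner formula for all bounded measurable compactly supported test functions, and
  nonnegativity of Theta_{d-1}).\<close>
definition support_measures ::
  "'a::euclidean_space set \<Rightarrow> (nat \<Rightarrow> ('a \<times> 'a) measure) \<Rightarrow> (nat \<Rightarrow> ('a \<times> 'a) measure) \<Rightarrow> bool"
where
  "support_measures G Tp Tm \<longleftrightarrow>
     (\<forall>i < DIM('a).
        sets (Tp i) = sets borel \<and> sets (Tm i) = sets borel \<and>
        (AE xu in Tp i. xu \<in> Nor G) \<and> (AE xu in Tm i. xu \<in> Nor G) \<and>
        (\<exists>N \<in> sets borel. emeasure (Tp i) N = 0 \<and> emeasure (Tm i) (UNIV - N) = 0) \<and>
        (\<forall>K c. compact K \<and> c > 0 \<longrightarrow>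
           (\<integral>\<^sup>+ xu. indicator K (fst xu) *
               ennreal (real_of_ereal (min (reach G (fst xu) (snd xu)) (ereal c)) ^ (DIM('a) - i))
             \<partial>(Tp i)) < \<infinity> \<and>
           (\<integral>\<^sup>+ xu. indicator K (fst xu) *
               ennreal (real_of_ereal (min (reach G (fst xu) (snd xu)) (ereal c)) ^ (DIM('a) - i))
             \<partial>(Tm i)) < \<infinity>)) \<and>
     emeasure (Tm (DIM('a) - 1)) UNIV = 0 \<and>
     (\<forall>f :: 'a \<Rightarrow> real.
        f \<in> borel_measurable borel \<and> bounded (range f) \<and>
        (\<exists>K. compact K \<and> (\<forall>z. z \<notin> K \<longrightarrow> f z = 0)) \<longrightarrow>
        (LINT z : (- G) | lborel. f z) =
        (\<Sum>j = 1..DIM('a). real ((DIM('a) - 1) choose (j - 1)) *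
           ((\<integral>xu. (LBINT t = ereal 0 .. reach G (fst xu) (snd xu).
                        f (fst xu + t *\<^sub>R snd xu) * t ^ (j - 1)) \<partial>(Tp (DIM('a) - j)))
          - (\<integral>xu. (LBINT t = ereal 0 .. reach G (fst xu) (snd xu).
                        f (fst xu + t *\<^sub>R snd xu) * t ^ (j - 1)) \<partial>(Tm (DIM('a) - j))))))"

definition solid :: "'a::euclidean_space set \<Rightarrow> bool" where
  "solid F \<longleftrightarrow> compact F \<and> closure (interior F) = F \<and> emeasure lborel (frontier F) = 0"

definition co :: "'a::euclidean_space set \<Rightarrow> 'a set" where
  "co F = closure (- F)"

definition Rfl :: "'a::euclidean_space \<times> 'a \<Rightarrow> 'a \<times> 'a" where
  "Rfl xu = (fst xu, - snd xu)"

definition Nor_e :: "'a::euclidean_space set \<Rightarrow> ('a \<times> 'a) set" where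
  "Nor_e F = Nor F \<union> Rfl ` Nor (co F)"

text \<open>Te is Theta_{d-1}(F,.) on Nor_e(F): it coincides with Theta_{d-1}(F,.) on Borel subsets of
  Nor(F) and with Theta_{d-1}(F^*, R(.)) on Borel subsets of R(Nor(F^*)) (sign (-1)^0 = 1).\<close>
definition ext_top_measure ::
  "'a::euclidean_space set \<Rightarrow> (nat \<Rightarrow> ('a \<times> 'a) measure) \<Rightarrow> (nat \<Rightarrow> ('a \<times> 'a) measure)
     \<Rightarrow> ('a \<times> 'a) measure \<Rightarrow> bool" where
  "ext_top_measure F Tp Tps Te \<longleftrightarrow>
     sets Te = sets borel \<and> (AE xu in Te. xu \<in> Nor_e F) \<and>
     (\<forall>A \<in> sets borel. A \<subseteq> Nor F \<longrightarrow> emeasure Te A = emeasure (Tp (DIM('a) - 1)) A) \<and>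
     (\<forall>A \<in> sets borel. A \<subseteq> Rfl ` Nor (co F) \<longrightarrow>
         emeasure Te A = emeasure (Tps (DIM('a) - 1)) (Rfl ` A))"

definition Sigma_cyl :: "'a::euclidean_space set \<Rightarrow> (real \<times> 'a \<times> 'a) set" where
  "Sigma_cyl F = {(t, x, u). (x, u) \<in> Nor_e F}"

definition Sigma_T :: "'a::euclidean_space set \<Rightarrow> real \<Rightarrow> (real \<times> 'a \<times> 'a) set" where
  "Sigma_T F T = {(t, x, u). \<bar>t\<bar> \<le> T \<and> (x, u) \<in> Nor_e F}"

text \<open>Local magnification map tau_eps (used only for z outside dF, S_F, S_{F*}).\<close>
definition tau :: "'a::euclidean_space set \<Rightarrow> real \<Rightarrow> 'a \<Rightarrow> real \<times> 'a \<times> 'a" where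
  "tau F e z = (if z \<notin> F then (dist_set F z / e, proj F z, unitn F z)
                else (- dist_set (co F) z / e, proj (co F) z, - unitn (co F) z))"

definition tau_img :: "'a::euclidean_space set \<Rightarrow> real \<Rightarrow> 'a set \<Rightarrow> (real \<times> 'a \<times> 'a) set" where
  "tau_img F e A = tau F e ` (A - (frontier F \<union> skeleton F \<union> skeleton (co F)))"

definition ess_bounded :: "'a::euclidean_space set \<Rightarrow> (real \<Rightarrow> 'a set) \<Rightarrow> real \<Rightarrow> bool" where
  "ess_bounded F A T \<longleftrightarrow>
     (\<forall>e \<in> {0..1}. A e \<in> sets borel \<and> bounded (A e)) \<and> A 0 \<subseteq> frontier F \<and>
     ((\<lambda>e. measure lborel (A e - parset (frontier F) (e * T)) / e) \<longlongrightarrow> 0) (at_right 0)"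

text \<open>Differentiability at dF with derivative B, w.r.t. M = mu_1 x Theta_{d-1}(F,.)
  (the M-measure of the possibly non-measurable set tau_eps(A(eps)) \<triangle> B is taken as
  outer measure, which agrees with M on measurable sets).\<close>
definition differentiable_at_bd ::
  "'a::euclidean_space set \<Rightarrow> ('a \<times> 'a) measure \<Rightarrow> (real \<Rightarrow> 'a set) \<Rightarrow> (real \<times> 'a \<times> 'a) set \<Rightarrow> bool"
where
  "differentiable_at_bd F Te A B \<longleftrightarrow>
     B \<in> sets borel \<and> B \<subseteq> Sigma_cyl F \<and>
     (\<exists>T > 0. ess_bounded F A T) \<and>
     ((\<lambda>e. outer_measure_of (lborel \<Otimes>\<^sub>M Te)
             ((tau_img F e (A e) - B) \<union> (B - tau_img F e (A e)))) \<longlongrightarrow> 0) (at_right 0)"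

end

theory Submission
  imports Defs
begin

text \<open>
  Near the boundary the mass of \<open>A(\<epsilon>) \<setminus> F\<close> is, up to \<open>o(\<epsilon>)\<close>, the integral of \<open>f\<^sub>+ \<circ> p\<^sub>F\<close>
  over \<open>A(\<epsilon>) \<setminus> F\<close>. The local Steiner formula turns this integral into a sum of integrals along the
  normal rays. The terms with \<open>j \<ge> 2\<close> carry a factor \<open>(\<epsilon>T)\<^sup>j\<close> and vanish after division by \<open>\<epsilon>\<close>;
  substituting \<open>t = \<epsilon>s\<close> in the term \<open>j = 1\<close> gives the integral of \<open>f\<^sub>+\<close> over the magnified set
  \<open>\<tau>\<^sub>\<epsilon>(A(\<epsilon>))\<close>, up to the graph of the reach function, which is a null set. The same applies to the
  closed complement \<open>F\<^sup>*\<close>. Since \<open>f\<^sub>+\<close> and \<open>f\<^sub>-\<close> are bounded on the boundary, the integrals over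
  \<open>\<tau>\<^sub>\<epsilon>(A(\<epsilon>))\<close> and over \<open>B\<close> differ by at most a constant times the measure of the symmetric
  difference. That the skeleton is a null set is itself a consequence of the Steiner formula, because
  no point \<open>x + tu\<close> with \<open>0 < t < r(x,u)\<close> lies in it.
\<close>

section \<open>Metric projection, normal bundle and reach\<close>

text \<open>Measurability of the magnified set is bypassed: it is enclosed between a Borel set of
  rays and the union of that set with the graphs of two reach functions. Along these rays the
  parameter stays strictly below the reach, because only there is the foot point certainly the
  unique nearest point; ray ends are what the graphs collect. A bound on the outer measure of the
  symmetric difference then becomes a bound for an honest Borel set. The second obstacle is that the
  set itself moves with \<open>e\<close>. The Steiner error must be uniform over all Borel sets in
  the layer of width \<open>e * T\<close>, so its constant may depend only on \<open>T\<close> and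
  on the integrals of the boundary density against the total variations. This is where integrability
  against every support measure enters, not only against the top one. Fubini on the normal cylinder
  requires the glued top measure to be sigma-finite; this comes from the integrability condition on
  the reach. Both sides of the boundary are treated by one argument, the inner one being transported
  by reflecting the normal and the height.\<close>

lemma skeleton_disjoint: "skeleton G \<inter> G = {}"
  by (auto simp: skeleton_def)

lemma proj_nearest:
  fixes G :: "'a::euclidean_space set"
  assumes "closed G" "G \<noteq> {}" "z \<notin> skeleton G"
  shows "proj G z \<in> G" "dist z (proj G z) = infdist z G"
proof -
  obtain x where x: "x \<in> G" "infdist z G = dist z x"
    using infdist_attains_inf[OF assms(1,2)] by metis
  have "proj G z \<in> G \<and> dist z (proj G z) = infdist z G"
    unfolding proj_def
    by (rule theI[of _ x]) (use x assms(3) in \<open>auto simp: skeleton_def\<close>)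
  then show "proj G z \<in> G" "dist z (proj G z) = infdist z G" by auto
qed

lemma proj_eqI:
  assumes "z \<notin> skeleton G" "x \<in> G" "dist z x = infdist z G"
  shows "proj G z = x"
  unfolding proj_def
  by (rule the_equality) (use assms in \<open>auto simp: skeleton_def\<close>)

lemma infdist_pos_of_notin:
  assumes "closed G" "G \<noteq> {}" "z \<notin> G"
  shows "infdist z G > 0"
  using assms by (metis infdist_nonneg in_closed_iff_infdist_zero order_le_less)

text \<open>The estimates close up: \<open>r * norm u\<close> is at most the norm of
  \<open>x + r *\<^sub>R u - y\<close>, which is at most
  \<open>(r - s) * norm u + s * norm u\<close>. Equality in the triangle inequality makes the two
  summands parallel, and strictness of \<open>s < r\<close> allows cancelling the common factor,
  which leaves \<open>y = x\<close>.\<close>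

lemma nearest_on_segment:
  fixes x u y :: "'a::euclidean_space"
  assumes x: "x \<in> G" "infdist (x + r *\<^sub>R u) G = r * norm u" and s: "0 \<le> s" "s < r"
    and y: "y \<in> G" "dist (x + s *\<^sub>R u) y \<le> s * norm u"
  shows "y = x"
proof (cases "u = 0")
  case True
  then show ?thesis using y by simp
next
  case False
  let ?a = "(r - s) *\<^sub>R u" and ?b = "x + s *\<^sub>R u - y"
  have ab: "?a + ?b = x + r *\<^sub>R u - y" by (simp add: algebra_simps)
  have "r * norm u \<le> norm (?a + ?b)"
    using infdist_le[OF y(1), of "x + r *\<^sub>R u"] x(2) by (simp only: ab dist_norm)
  moreover have na: "norm ?a = r * norm u - s * norm u"
    using s by (simp add: left_diff_distrib)
  moreover have "norm ?b \<le> s * norm u" using y(2) by (simp only: dist_norm)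
  moreover have "norm (?a + ?b) \<le> norm ?a + norm ?b" by (rule norm_triangle_ineq)
  ultimately have eq: "norm (?a + ?b) = norm ?a + norm ?b" and nb: "norm ?b = s * norm u"
    by linarith+
  have "norm ?a *\<^sub>R ?b = norm ?b *\<^sub>R ?a"
    using eq by (simp only: norm_triangle_eq)
  then have "((r - s) * norm u) *\<^sub>R ?b = ((r - s) * norm u) *\<^sub>R (s *\<^sub>R u)"
    unfolding na nb by (simp add: algebra_simps)
  then have "?b = s *\<^sub>R u" by (subst (asm) scaleR_cancel_left) (use s False in simp)
  then show ?thesis by simp
qed

lemma infdist_on_segment:
  fixes x u :: "'a::euclidean_space"
  assumes cl: "closed G" and x: "x \<in> G" "infdist (x + r *\<^sub>R u) G = r * norm u"
    and s: "0 \<le> s" "s < r"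
  shows "infdist (x + s *\<^sub>R u) G = s * norm u" "x + s *\<^sub>R u \<notin> skeleton G"
    "proj G (x + s *\<^sub>R u) = x"
proof -
  let ?z = "x + s *\<^sub>R u"
  have dx: "dist ?z x = s * norm u" using s by (simp add: dist_norm)
  obtain y where y: "y \<in> G" "infdist ?z G = dist ?z y"
    using infdist_attains_inf[OF cl] x(1) by blast
  have "infdist ?z G \<le> s * norm u" using infdist_le[OF x(1), of ?z] dx by simp
  with y have "y = x" using nearest_on_segment[OF x s] by simp
  with y dx show 1: "infdist ?z G = s * norm u" by simp
  show 2: "?z \<notin> skeleton G"
    proof
    assume "?z \<in> skeleton G"
    then obtain a b where "a \<in> G" "b \<in> G" "a \<noteq> b" "dist ?z a \<le> s * norm u" "dist ?z b \<le> s * norm u"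
      using 1 by (auto simp: skeleton_def)
    then show False using nearest_on_segment[OF x s, of a] nearest_on_segment[OF x s, of b] by simp
  qed
  show "proj G ?z = x" by (rule proj_eqI[OF 2 x(1)]) (simp add: dx 1)
qed

text \<open>The supremum runs over parameters with unique foot point \<open>x\<close>, and at its
  end the point may lie in the skeleton. The distance condition is closed, so it survives the limit
  from the left; conversely it forces uniqueness at every smaller parameter. With projection and
  skeleton gone from the right-hand side, the reach becomes accessible to measurability
  arguments.\<close>

lemma reach_ge_iff:
  fixes x u :: "'a::euclidean_space"
  assumes cl: "closed G" "G \<noteq> {}" and r: "0 < r"
  shows "ereal r \<le> reach G x u \<longleftrightarrow> x \<in> G \<and> infdist (x + r *\<^sub>R u) G = r * norm u"
proof
  let ?S = "{s. s > 0 \<and> x + s *\<^sub>R u \<notin> skeleton G \<and> proj G (x + s *\<^sub>R u) = x}"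
  have S: "x \<in> G \<and> infdist (x + s *\<^sub>R u) G = s * norm u" if "s \<in> ?S" for s
  proof -
    have "proj G (x + s *\<^sub>R u) \<in> G" "dist (x + s *\<^sub>R u) (proj G (x + s *\<^sub>R u)) = infdist (x + s *\<^sub>R u) G"
      using proj_nearest[OF cl, of "x + s *\<^sub>R u"] that by simp_all
    then show ?thesis using that by (simp add: dist_norm)
  qed
  { assume le: "ereal r \<le> reach G x u"
    have step: "x \<in> G \<and> infdist (x + s *\<^sub>R u) G = s * norm u" if s: "0 \<le> s" "s < r" for s
    proof -
      have "ereal s < Sup (ereal ` ?S)" using le s less_le_trans[of "ereal s" "ereal r"] unfolding reach_def by simp
      then obtain t where t: "t \<in> ?S" "s < t" by (auto simp: less_Sup_iff)
      show ?thesis using S[OF t(1)] infdist_on_segment(1)[OF cl(1) _ _ s(1) t(2)] by auto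
    qed
    have "((\<lambda>s. infdist (x + s *\<^sub>R u) G) \<longlongrightarrow> infdist (x + r *\<^sub>R u) G) (at_left r)"
      by (intro tendsto_intros)
    moreover have "((\<lambda>s. infdist (x + s *\<^sub>R u) G) \<longlongrightarrow> r * norm u) (at_left r)"
    proof (rule Lim_transform_eventually)
      show "((\<lambda>s. s * norm u) \<longlongrightarrow> r * norm u) (at_left r)" by (intro tendsto_intros)
      show "\<forall>\<^sub>F s in at_left r. s * norm u = infdist (x + s *\<^sub>R u) G"
        using eventually_at_left_real[OF r] by eventually_elim (use step in auto)
    qed
    ultimately have "infdist (x + r *\<^sub>R u) G = r * norm u"
      using tendsto_unique trivial_limit_at_left_real by blast
    with step[of 0] r show "x \<in> G \<and> infdist (x + r *\<^sub>R u) G = r * norm u" by auto }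
  { assume a: "x \<in> G \<and> infdist (x + r *\<^sub>R u) G = r * norm u"
    have "ereal s \<le> reach G x u" if "0 < s" "s < r" for s
      unfolding reach_def
      by (rule Sup_upper) (use infdist_on_segment[OF cl(1), of x r u s] a that in auto)
    then have "\<forall>\<^sub>F s in at_left r. ereal s \<le> reach G x u"
      using eventually_at_left_real[OF r] by (auto elim: eventually_mono)
    then show "ereal r \<le> reach G x u"
      by (intro tendsto_upperbound[where F="at_left r" and f=ereal]) (auto intro!: tendsto_intros) }
qed

text \<open>The supremum of the empty set in \<open>ereal\<close> is \<open>-\<infinity>\<close> and
  not 0. Hence no finite nonpositive number is ever a value of the reach.\<close>

lemma reach_eq_minus_infinity:
  assumes "\<not> 0 < reach G x u"
  shows "reach G x u = -\<infinity>"
proof -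
  have "{s. s > 0 \<and> x + s *\<^sub>R u \<notin> skeleton G \<and> proj G (x + s *\<^sub>R u) = x} = {}" (is "?S = _")
  proof (rule ccontr)
    assume "?S \<noteq> {}"
    then obtain s where "s \<in> ?S" by auto
    then have "ereal s \<le> reach G x u" "0 < s" unfolding reach_def by (auto intro: Sup_upper)
    then show False using assms less_le_trans[of 0 "ereal s" "reach G x u"] by simp
  qed
  then have "reach G x u = Sup {}" unfolding reach_def by (simp only: image_empty)
  then show ?thesis by (simp add: bot_ereal_def)
qed

lemma ereal_pos_iff_ge_inverse: "0 < r \<longleftrightarrow> (\<exists>n. ereal (inverse (real (Suc n))) \<le> r)" for r :: ereal
proof
  assume "0 < r"
  then obtain q where q: "0 < ereal q" "ereal q < r" using ereal_dense2 by blast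
  then obtain n where "inverse (real (Suc n)) < q" using reals_Archimedean by auto
  then have "ereal (inverse (real (Suc n))) \<le> ereal q" by (simp del: of_nat_Suc)
  with q have "ereal (inverse (real (Suc n))) \<le> r" using order_trans less_imp_le by blast
  then show "\<exists>n. ereal (inverse (real (Suc n))) \<le> r" ..
next
  assume "\<exists>n. ereal (inverse (real (Suc n))) \<le> r"
  then obtain n where n: "ereal (inverse (real (Suc n))) \<le> r" ..
  have "0 < ereal (inverse (real (Suc n)))" by simp
  then show "0 < r" using n by (rule less_le_trans)
qed

text \<open>Superlevel sets at positive finite levels are closed by \<open>reach_ge_iff\<close>. The
  level \<open>\<infinity>\<close> is a countable intersection of these, and all finite nonpositive
  levels give the single set where the reach is positive, a countable union.\<close>

lemma reach_measurable:
  fixes G :: "'a::euclidean_space set"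
  assumes cl: "closed G" "G \<noteq> {}"
  shows "(\<lambda>xu. reach G (fst xu) (snd xu)) \<in> borel_measurable borel"
proof (rule borel_measurableI_ge)
  fix y :: ereal
  have pos: "{xu. ereal s \<le> reach G (fst xu) (snd xu)} \<in> sets borel" if "0 < s" for s
  proof -
    have *: "{xu. ereal s \<le> reach G (fst xu) (snd xu)} =
        (G \<times> UNIV) \<inter> {xu. infdist (fst xu + s *\<^sub>R snd xu) G = s * norm (snd xu)}"
      by (auto simp: reach_ge_iff[OF cl that])
    show ?thesis unfolding *
      by (intro borel_closed closed_Int closed_Times cl closed_UNIV closed_Collect_eq continuous_intros)
  qed
  have gr0: "{xu. 0 < reach G (fst xu) (snd xu)} \<in> sets borel"
  proof -
    have *: "{xu. 0 < reach G (fst xu) (snd xu)} = (\<Union>n. {xu. ereal (inverse (real (Suc n))) \<le> reach G (fst xu) (snd xu)})"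
      by (subst ereal_pos_iff_ge_inverse) auto
    show ?thesis unfolding * by (intro sets.countable_UN subsetI) (auto intro!: pos simp del: of_nat_Suc)
  qed
  have "{xu. y \<le> reach G (fst xu) (snd xu)} \<in> sets borel"
  proof (cases y)
    case (real s)
    show ?thesis
    proof (cases "0 < s")
      case True
      then show ?thesis using pos real by simp
    next
      case False
      have "{xu. y \<le> reach G (fst xu) (snd xu)} = {xu. 0 < reach G (fst xu) (snd xu)}"
      proof (intro Collect_cong iffI)
        fix xu :: "'a \<times> 'a"
        show "y \<le> reach G (fst xu) (snd xu) \<Longrightarrow> 0 < reach G (fst xu) (snd xu)"
          using reach_eq_minus_infinity[of G "fst xu" "snd xu"] real by force
        show "0 < reach G (fst xu) (snd xu) \<Longrightarrow> y \<le> reach G (fst xu) (snd xu)"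
          using False real order_trans[of y 0 "reach G (fst xu) (snd xu)"] by simp
      qed
      then show ?thesis using gr0 by simp
    qed
  next
    case PInf
    have "{xu. y \<le> reach G (fst xu) (snd xu)} = (\<Inter>n. {xu. ereal (real (Suc n)) \<le> reach G (fst xu) (snd xu)})"
    proof (intro equalityI subsetI; clarsimp simp: PInf simp del: of_nat_Suc)
      fix x u assume a: "\<forall>n. ereal (real (Suc n)) \<le> reach G x u"
      show "reach G x u = \<infinity>"
      proof (rule ereal_top)
        fix B show "ereal B \<le> reach G x u"
        proof -
          obtain n where "B \<le> real n" using real_arch_simple by blast
          then have "ereal B \<le> ereal (real (Suc n))" by simp
          also have "\<dots> \<le> reach G x u" using a ..
          finally show ?thesis .
        qed
      qed
    qed
    then show ?thesis
      by (simp only:) (intro sets.countable_INT subsetI, auto intro!: pos simp del: of_nat_Suc)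
  next
    case MInf
    then show ?thesis by simp
  qed
  then show "{xu \<in> space borel. y \<le> reach G (fst xu) (snd xu)} \<in> sets borel" by simp
qed

text \<open>Strictness leaves room for some \<open>r\<close> between \<open>t\<close> and the reach,
  so that \<open>x + t *\<^sub>R u\<close> is interior to a segment with foot point
  \<open>x\<close>. At \<open>t\<close> equal to the reach uniqueness may fail.\<close>

lemma reach_gt_imp:
  fixes x u :: "'a::euclidean_space"
  assumes cl: "closed G" "G \<noteq> {}" and u: "norm u = 1" and t: "0 < t" "ereal t < reach G x u"
  shows "x \<in> G" "x + t *\<^sub>R u \<notin> G" "x + t *\<^sub>R u \<notin> skeleton G" "proj G (x + t *\<^sub>R u) = x"
    "infdist (x + t *\<^sub>R u) G = t" "unitn G (x + t *\<^sub>R u) = u"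
proof -
  obtain r where r: "t < r" "ereal r < reach G x u"
    using ereal_dense2[OF t(2)] by auto
  with t have "x \<in> G" and r2: "infdist (x + r *\<^sub>R u) G = r * norm u"
    using reach_ge_iff[OF cl, of r x u] by auto
  note seg = infdist_on_segment[OF cl(1) this less_imp_le[OF t(1)] r(1)]
  show "x \<in> G" by fact
  show "infdist (x + t *\<^sub>R u) G = t" using seg u by simp
  then show "x + t *\<^sub>R u \<notin> G" using t by auto
  show "x + t *\<^sub>R u \<notin> skeleton G" "proj G (x + t *\<^sub>R u) = x" using seg by auto
  then show "unitn G (x + t *\<^sub>R u) = u"
    using \<open>infdist (x + t *\<^sub>R u) G = t\<close> t by (simp add: unitn_def dist_set_def)
qed

text \<open>Polar coordinates of a point outside \<open>G\<close>. Only a weak inequality with the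
  reach can be expected, since \<open>z\<close> may be the last point of its ray that projects to
  the foot point.\<close>

lemma notin_decompose:
  fixes z :: "'a::euclidean_space"
  assumes cl: "closed G" "G \<noteq> {}" and z: "z \<notin> skeleton G" "z \<notin> G"
  shows "0 < infdist z G" "z = proj G z + infdist z G *\<^sub>R unitn G z" "norm (unitn G z) = 1"
    "ereal (infdist z G) \<le> reach G (proj G z) (unitn G z)"
proof -
  show pos: "0 < infdist z G" by (rule infdist_pos_of_notin[OF cl z(2)])
  show eq: "z = proj G z + infdist z G *\<^sub>R unitn G z"
    using pos by (simp add: unitn_def dist_set_def)
  show 1: "norm (unitn G z) = 1"
    using pos proj_nearest(2)[OF cl z(1)] by (simp add: unitn_def dist_set_def dist_norm)
  show "ereal (infdist z G) \<le> reach G (proj G z) (unitn G z)"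
    unfolding reach_ge_iff[OF cl pos] eq[symmetric] 1 using proj_nearest[OF cl z(1)] by simp
qed

lemma Nor_iff:
  fixes G :: "'a::euclidean_space set"
  assumes cl: "closed G" "G \<noteq> {}"
  shows "(x, u) \<in> Nor G \<longleftrightarrow> norm u = 1 \<and> 0 < reach G x u"
proof
  assume "(x, u) \<in> Nor G"
  then obtain z where z: "z \<notin> skeleton G" "z \<notin> G" "x = proj G z" "u = unitn G z"
    by (auto simp: Nor_def)
  then show "norm u = 1 \<and> 0 < reach G x u"
    using notin_decompose[OF cl z(1,2)] less_le_trans[of 0 "ereal (infdist z G)" "reach G x u"] by simp
next
  assume a: "norm u = 1 \<and> 0 < reach G x u"
  then obtain t where "0 < ereal t" "ereal t < reach G x u" using ereal_dense2 by blast
  then have t: "0 < t" "ereal t < reach G x u" by auto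
  note * = reach_gt_imp[OF cl conjunct1[OF a] t]
  show "(x, u) \<in> Nor G" unfolding Nor_def
    using * by (intro CollectI exI[of _ "x + t *\<^sub>R u"]) auto
qed

lemma Nor_subset_frontier:
  fixes G :: "'a::euclidean_space set"
  assumes cl: "closed G" "G \<noteq> {}" and "(x, u) \<in> Nor G"
  shows "x \<in> frontier G"
proof -
  have u: "norm u = 1" "0 < reach G x u" using assms Nor_iff[OF cl] by auto
  obtain t0 where "0 < ereal t0" "ereal t0 < reach G x u" using ereal_dense2[OF u(2)] by blast
  then have t0: "0 < t0" "ereal t0 < reach G x u" by auto
  have "x \<in> G" by (rule reach_gt_imp(1)[OF cl u(1) t0])
  moreover have "x \<notin> interior G"
  proof
    assume "x \<in> interior G"
    then obtain e where e: "e > 0" "ball x e \<subseteq> G" by (auto simp: mem_interior)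
    \<comment> \<open>Small enough to stay in the ball inside \<open>G\<close>, yet below the reach,
      where the point must lie outside \<open>G\<close>.\<close>
    define t where "t = min t0 (e / 2)"
    have t: "0 < t" "ereal t < reach G x u" "t < e"
      using t0 e by (auto simp: t_def min_def intro: le_less_trans[of _ "ereal t0"])
    have "x + t *\<^sub>R u \<in> ball x e" using t u by (simp add: dist_norm)
    then show False using e reach_gt_imp(2)[OF cl u(1) t(1,2)] by auto
  qed
  ultimately show ?thesis by (simp add: frontier_def cl(1))
qed

lemma Nor_measurable:
  fixes G :: "'a::euclidean_space set"
  assumes cl: "closed G" "G \<noteq> {}"
  shows "Nor G \<in> sets borel"
proof -
  have "Nor G = {xu \<in> space borel. norm (snd xu) = 1 \<and> 0 < reach G (fst xu) (snd xu)}"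
    using Nor_iff[OF cl] by auto
  also have "\<dots> \<in> sets borel"
    by (intro sets.sets_Collect_conj borel_measurable_less reach_measurable[OF cl] borel_measurable_const borel_measurable_eq borel_measurable_continuous_onI continuous_intros)
  finally show ?thesis .
qed

section \<open>Borel measurability of the skeleton and of the metric projection\<close>

lemma closed_infdist_eq: "closed {z. infdist z A = infdist z B}"
  by (intro closed_Collect_eq continuous_intros)

text \<open>Removes a quantifier over points: the existence of a nearest point inside
  \<open>C\<close> becomes an equality of two continuous functions of \<open>z\<close>, which
  defines a closed set.\<close>

lemma infdist_eq_iff_nearest:
  fixes G :: "'a::euclidean_space set"
  assumes "closed G" "closed C" "G \<inter> C \<noteq> {}"
  shows "infdist z (G \<inter> C) = infdist z G \<longleftrightarrow> (\<exists>x\<in>G \<inter> C. dist z x = infdist z G)"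
proof
  assume a: "infdist z (G \<inter> C) = infdist z G"
  obtain x where "x \<in> G \<inter> C" "infdist z (G \<inter> C) = dist z x"
    using infdist_attains_inf[of "G \<inter> C" z] assms by (metis closed_Int)
  with a show "\<exists>x\<in>G \<inter> C. dist z x = infdist z G" by auto
next
  assume "\<exists>x\<in>G \<inter> C. dist z x = infdist z G"
  then obtain x where x: "x \<in> G \<inter> C" "dist z x = infdist z G" by auto
  have "infdist z G \<le> infdist z (G \<inter> C)" by (rule infdist_mono) (use assms in auto)
  moreover have "infdist z (G \<inter> C) \<le> dist z x" by (rule infdist_le) (use x in auto)
  ultimately show "infdist z (G \<inter> C) = infdist z G" using x by simp
qed

lemma nearest_in_measurable:
  fixes G :: "'a::euclidean_space set"
  assumes "closed G" "closed C"
  shows "{z. \<exists>x\<in>G \<inter> C. dist z x = infdist z G} \<in> sets borel"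
proof (cases "G \<inter> C = {}")
  case False
  then have "{z. \<exists>x\<in>G \<inter> C. dist z x = infdist z G} = {z. infdist z (G \<inter> C) = infdist z G}"
    using infdist_eq_iff_nearest[OF assms False] by auto
  then show ?thesis by (simp only: borel_closed closed_infdist_eq)
qed simp

text \<open>Two distinct nearest points are separated by a pair of parallel rational half-spaces
  orthogonal to a coordinate axis.\<close>
lemma skeleton_measurable:
  fixes G :: "'a::euclidean_space set"
  assumes cl: "closed G"
  shows "skeleton G \<in> sets borel"
proof -
  define H where "H b q = {z. \<exists>x\<in>G \<inter> {x. x \<bullet> b \<le> q}. dist z x = infdist z G}" for b q
  define K where "K b q = {z. \<exists>x\<in>G \<inter> {x. q \<le> x \<bullet> b}. dist z x = infdist z G}" for b q
  have "skeleton G = (\<Union>b\<in>Basis. \<Union>q\<in>\<rat>. \<Union>q'\<in>\<rat> \<inter> {q<..}. H b q \<inter> K b q')" (is "_ = ?R")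
  proof (intro equalityI subsetI)
    fix z assume "z \<in> skeleton G"
    then obtain x y where xy: "x \<in> G" "y \<in> G" "x \<noteq> y" "dist z x = infdist z G" "dist z y = infdist z G"
      by (auto simp: skeleton_def)
    then obtain b where b: "b \<in> Basis" "x \<bullet> b \<noteq> y \<bullet> b" by (metis euclidean_eqI)
    have *: "z \<in> ?R" if lt: "x \<bullet> b < y \<bullet> b" "x \<in> G" "y \<in> G" "dist z x = infdist z G" "dist z y = infdist z G" for x y
    proof -
      obtain q where q: "q \<in> \<rat>" "x \<bullet> b < q" "q < y \<bullet> b" using Rats_dense_in_real[OF lt(1)] by blast
      obtain q' where q': "q' \<in> \<rat>" "q < q'" "q' < y \<bullet> b" using Rats_dense_in_real[OF q(3)] by blast
      have "z \<in> H b q" unfolding H_def using lt q by (intro CollectI bexI[of _ x]) auto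
      moreover have "z \<in> K b q'" unfolding K_def using lt q' by (intro CollectI bexI[of _ y]) auto
      ultimately show ?thesis using b q q' by blast
    qed
    show "z \<in> ?R"
      using b xy *[of x y] *[of y x] by (cases "x \<bullet> b < y \<bullet> b") auto
  next
    fix z assume "z \<in> ?R"
    then obtain b q q' where q: "q < q'" "z \<in> H b q" "z \<in> K b q'" by auto
    then obtain x y where "x \<in> G" "y \<in> G" "x \<bullet> b \<le> q" "q' \<le> y \<bullet> b" "dist z x = infdist z G" "dist z y = infdist z G"
      by (auto simp: H_def K_def)
    then show "z \<in> skeleton G" unfolding skeleton_def using q(1)
      by (intro CollectI exI[of _ x] exI[of _ y]) auto
  qed
  also have "\<dots> \<in> sets borel"
  proof (intro sets.countable_UN'' sets.Int countable_finite[OF finite_Basis] countable_Int1 countable_rat)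
    show "H b q \<in> sets borel" for b q unfolding H_def
      by (intro nearest_in_measurable cl) (intro closed_Collect_le continuous_intros)
    show "K b q \<in> sets borel" for b q unfolding K_def
      by (intro nearest_in_measurable cl) (intro closed_Collect_le continuous_intros)
  qed
  finally show ?thesis .
qed

text \<open>On the skeleton \<open>proj\<close> is an unspecified \<open>THE\<close>, so the value 0
  is put there. Elsewhere the nearest point is unique, and the preimage of a closed \<open>C\<close>
  is the set of points having a nearest point in \<open>C\<close>.\<close>

lemma proj_measurable_off_skeleton:
  fixes G :: "'a::euclidean_space set"
  assumes cl: "closed G" "G \<noteq> {}"
  shows "(\<lambda>z. if z \<in> skeleton G then 0 else proj G z) \<in> borel_measurable borel"
proof -
  let ?p = "\<lambda>z. if z \<in> skeleton G then 0 else proj G z"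
  have "?p -` C \<inter> space borel \<in> sets borel" if C: "closed C" for C
  proof -
    have "?p -` C = (if 0 \<in> C then skeleton G else {}) \<union>
        ({z. \<exists>x\<in>G \<inter> C. dist z x = infdist z G} - skeleton G)"
    proof (intro equalityI subsetI)
      fix z assume "z \<in> ?p -` C"
      then show "z \<in> (if 0 \<in> C then skeleton G else {}) \<union> ({z. \<exists>x\<in>G \<inter> C. dist z x = infdist z G} - skeleton G)"
        using proj_nearest[OF cl, of z] by (auto split: if_splits)
    next
      fix z assume "z \<in> (if 0 \<in> C then skeleton G else {}) \<union> ({z. \<exists>x\<in>G \<inter> C. dist z x = infdist z G} - skeleton G)"
      then show "z \<in> ?p -` C" using proj_eqI[of z G] by (auto split: if_splits)
    qed
    also have "\<dots> \<in> sets borel"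
      using skeleton_measurable[OF cl(1)] nearest_in_measurable[OF cl(1) C] by auto
    finally show ?thesis by simp
  qed
  then show ?thesis
    unfolding borel_eq_closed by (intro measurable_measure_of) auto
qed

section \<open>The Steiner formula along normal rays\<close>

text \<open>Borel substitute for the part of the magnified set that comes from outside
  \<open>G\<close>. The height \<open>s\<close> is the distance divided by \<open>e\<close>; the
  strict bound ensures that foot point and normal can be recovered from the point.\<close>

definition ray_set :: "'a::euclidean_space set \<Rightarrow> real \<Rightarrow> 'a set \<Rightarrow> (real \<times> 'a \<times> 'a) set" where
  "ray_set G e A = {(s, xu). 0 < s \<and> xu \<in> Nor G \<and>
     ereal (e * s) < reach G (fst xu) (snd xu) \<and> fst xu + (e * s) *\<^sub>R snd xu \<in> A}"

definition ray_integral :: "'a::euclidean_space set \<Rightarrow> ('a \<Rightarrow> real) \<Rightarrow> nat \<Rightarrow> 'a \<times> 'a \<Rightarrow> real" where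
  "ray_integral G g j xu = (LBINT t = ereal 0 .. reach G (fst xu) (snd xu).
     g (fst xu + t *\<^sub>R snd xu) * t ^ (j - 1))"

text \<open>Written as an iterated integral with \<open>N\<close> outside, the form in which the
  Steiner formula delivers it; Fubini is then invoked only for the glued measure
  \<open>Te\<close>.\<close>

definition ray_mass :: "'a::euclidean_space set \<Rightarrow> ('a \<times> 'a) measure \<Rightarrow> ('a \<Rightarrow> real) \<Rightarrow> real \<Rightarrow> 'a set \<Rightarrow> ennreal" where
  "ray_mass G N h e A =
     (\<integral>\<^sup>+ xu. \<integral>\<^sup>+ s. indicator (ray_set G e A) (s, xu) * ennreal (h (fst xu)) \<partial>lborel \<partial>N)"

definition proj_mass :: "'a::euclidean_space set \<Rightarrow> ('a \<Rightarrow> real) \<Rightarrow> 'a set \<Rightarrow> ennreal" where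
  "proj_mass G h A = (\<integral>\<^sup>+ z. indicator (A - G) z * ennreal (h (proj G z)) \<partial>lborel)"

definition boundary_error :: "'a::euclidean_space set \<Rightarrow> ('a \<Rightarrow> real) \<Rightarrow> ('a \<Rightarrow> real) \<Rightarrow> real \<Rightarrow> ennreal" where
  "boundary_error G f h e = (\<integral>\<^sup>+ z. indicator {z. 0 < dist_set G z \<and> dist_set G z \<le> e} z *
     ennreal \<bar>f z - h (proj G z)\<bar> \<partial>lborel)"

lemma ray_set_measurable:
  fixes G :: "'a::euclidean_space set"
  assumes cl: "closed G" "G \<noteq> {}" and A: "A \<in> sets borel"
  shows "ray_set G e A \<in> sets borel"
proof -
  have [measurable]: "(\<lambda>xu. reach G (fst xu) (snd xu)) \<in> borel_measurable borel"
    by (rule reach_measurable[OF cl])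
  have [measurable]: "Nor G \<in> sets borel" by (rule Nor_measurable[OF cl])
  note A[measurable]
  have [measurable]: "(\<lambda>p. fst (snd p) + (e * fst p) *\<^sub>R snd (snd p)) \<in>
      (borel :: (real \<times> 'a \<times> 'a) measure) \<rightarrow>\<^sub>M borel"
    by (intro borel_measurable_continuous_onI continuous_intros)
  have [measurable]: "snd \<in> (borel :: (real \<times> 'a \<times> 'a) measure) \<rightarrow>\<^sub>M borel"
      "fst \<in> (borel :: (real \<times> 'a \<times> 'a) measure) \<rightarrow>\<^sub>M borel"
    by (intro borel_measurable_continuous_onI continuous_intros)+
  have "(\<lambda>p. reach G (fst (snd p)) (snd (snd p))) \<in> borel_measurable (borel :: (real \<times> 'a \<times> 'a) measure)"
    by (rule measurable_compose[of snd _ borel "\<lambda>xu. reach G (fst xu) (snd xu)"]) measurable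
  note [measurable] = this
  have "ray_set G e A = {p \<in> space borel. 0 < fst p \<and> snd p \<in> Nor G \<and>
     ereal (e * fst p) < reach G (fst (snd p)) (snd (snd p)) \<and> fst (snd p) + (e * fst p) *\<^sub>R snd (snd p) \<in> A}"
    by (auto simp: ray_set_def)
  also have "\<dots> \<in> sets borel" by measurable
  finally show ?thesis .
qed

text \<open>Where the reach is \<open>-\<infinity>\<close> the interval integral switches to the
  reversed interval with a minus sign, so both branches have to be shown measurable.\<close>

lemma ray_integral_measurable:
  fixes G :: "'a::euclidean_space set"
  assumes cl: "closed G" "G \<noteq> {}" and g: "g \<in> borel_measurable borel"
  shows "ray_integral G g j \<in> borel_measurable borel"
proof -
  note g[measurable]
  have r: "(\<lambda>xu. reach G (fst xu) (snd xu)) \<in> borel_measurable borel"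
    by (rule reach_measurable[OF cl])
  note r[measurable]
  have [measurable]: "(\<lambda>p. reach G (fst (fst p)) (snd (fst p))) \<in>
      borel_measurable ((borel :: ('a \<times> 'a) measure) \<Otimes>\<^sub>M (lborel :: real measure))"
    by (rule measurable_compose[OF measurable_fst r])
  have "(\<lambda>p. fst (fst p) + snd p *\<^sub>R snd (fst p)) \<in>
      (borel :: (('a \<times> 'a) \<times> real) measure) \<rightarrow>\<^sub>M borel"
    by (intro borel_measurable_continuous_onI continuous_intros)
  then have [measurable]: "(\<lambda>p. fst (fst p) + snd p *\<^sub>R snd (fst p)) \<in>
      (borel :: ('a \<times> 'a) measure) \<Otimes>\<^sub>M (lborel :: real measure) \<rightarrow>\<^sub>M borel"
    by (simp add: borel_prod[symmetric] cong: measurable_cong_sets)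
  have "(\<lambda>xu. \<integral>t. (if ereal 0 < ereal t \<and> ereal t < reach G (fst xu) (snd xu) then 1 else 0) *
      (g (fst xu + t *\<^sub>R snd xu) * t ^ (j - 1)) \<partial>lborel) \<in> borel_measurable borel"
    by (rule lborel.borel_measurable_lebesgue_integral) (simp add: split_beta', measurable)
  moreover have "(\<lambda>xu. \<integral>t. (if reach G (fst xu) (snd xu) < ereal t \<and> ereal t < ereal 0 then 1 else 0) *
      (g (fst xu + t *\<^sub>R snd xu) * t ^ (j - 1)) \<partial>lborel) \<in> borel_measurable borel"
    by (rule lborel.borel_measurable_lebesgue_integral) (simp add: split_beta', measurable)
  ultimately show ?thesis
    unfolding ray_integral_def[abs_def] interval_lebesgue_integral_def set_lebesgue_integral_def
      einterval_def indicator_def mem_Collect_eq real_scaleR_def of_bool_def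
    by (intro measurable_If borel_measurable_uminus borel_measurable_const) (auto intro: borel_measurable_le r)
qed

text \<open>One side of the boundary. The locale is later instantiated with \<open>F\<close> for the
  outer layer and with \<open>co F\<close> for the inner one.\<close>

locale support_measure_pair =
  fixes G :: "'a::euclidean_space set" and Tp Tm :: "nat \<Rightarrow> ('a \<times> 'a) measure"
  assumes closed: "closed G" and nonempty: "G \<noteq> {}" and support: "support_measures G Tp Tm"
begin

lemmas cl = closed nonempty

lemma sets_Tp: "i < DIM('a) \<Longrightarrow> sets (Tp i) = sets borel"
  and sets_Tm: "i < DIM('a) \<Longrightarrow> sets (Tm i) = sets borel"
  and AE_Tp: "i < DIM('a) \<Longrightarrow> AE xu in Tp i. xu \<in> Nor G"
  and AE_Tm: "i < DIM('a) \<Longrightarrow> AE xu in Tm i. xu \<in> Nor G"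
  using support unfolding support_measures_def by blast+

text \<open>Nonnegativity of the top support measure makes the whole space null for its negative
  part, so any predicate whatsoever holds almost everywhere.\<close>

lemma AE_Tm_top: "AE xu in Tm (DIM('a) - 1). P xu"
proof (rule AE_I')
  have "sets (Tm (DIM('a) - 1)) = sets borel" by (rule sets_Tm) simp
  then show "UNIV \<in> null_sets (Tm (DIM('a) - 1))"
    using support unfolding support_measures_def null_sets_def by auto
qed auto

lemma steiner:
  assumes "g \<in> borel_measurable borel" "bounded (range g)" "compact K" "\<And>z. z \<notin> K \<Longrightarrow> g z = 0"
  shows "(LINT z : (- G) | lborel. g z) =
    (\<Sum>j = 1..DIM('a). real ((DIM('a) - 1) choose (j - 1)) *
      ((\<integral>xu. ray_integral G g j xu \<partial>(Tp (DIM('a) - j))) - (\<integral>xu. ray_integral G g j xu \<partial>(Tm (DIM('a) - j)))))"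
proof -
  have "g \<in> borel_measurable borel \<and> bounded (range g) \<and> (\<exists>K. compact K \<and> (\<forall>z. z \<notin> K \<longrightarrow> g z = 0))"
    using assms by blast
  then show ?thesis
    using support unfolding support_measures_def ray_integral_def by blast
qed

lemma ray_integral_Nor:
  assumes "xu \<in> Nor G"
  shows "ray_integral G g j xu = (\<integral>t. indicator {t. 0 < t \<and> ereal t < reach G (fst xu) (snd xu)} t *
     (g (fst xu + t *\<^sub>R snd xu) * t ^ (j - 1)) \<partial>lborel)"
proof -
  have "0 \<le> reach G (fst xu) (snd xu)"
    using assms Nor_iff[OF cl, of "fst xu" "snd xu"] by (simp add: less_imp_le)
  then show ?thesis
    by (simp add: ray_integral_def interval_lebesgue_integral_def set_lebesgue_integral_def einterval_def
        zero_ereal_def)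
qed

lemma skeleton_null: "AE z in lborel. z \<notin> skeleton G"
proof -
  note disj = skeleton_disjoint[of G]
  \<comment> \<open>The Steiner formula admits only compactly supported test functions, hence the
    intersection with balls.\<close>
  have "emeasure lborel (skeleton G \<inter> cball 0 (real n)) = 0" for n
  proof -
    let ?S = "skeleton G \<inter> cball 0 (real n)"
    let ?g = "indicator ?S :: 'a \<Rightarrow> real"
    have S: "?S \<in> sets borel" using skeleton_measurable[OF closed] by auto
    have 0: "ray_integral G ?g j xu = 0" if "xu \<in> Nor G" for j xu
    proof -
      have "norm (snd xu) = 1" using that Nor_iff[OF cl, of "fst xu" "snd xu"] by simp
      from reach_gt_imp(3)[OF cl this] 
      have "indicator {t. 0 < t \<and> ereal t < reach G (fst xu) (snd xu)} t *
         (?g (fst xu + t *\<^sub>R snd xu) * t ^ (j - 1)) = 0" for t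
        by (auto simp: indicator_def)
      then show ?thesis unfolding ray_integral_Nor[OF that] by (simp only: integral_zero)
    qed
    have "(LINT z : (- G) | lborel. ?g z) = 0"
    proof (subst steiner[of _ "cball 0 (real n)"])
      show "bounded (range ?g)" by (rule boundedI[of _ 1]) (auto simp: indicator_def)
      have "(\<integral>xu. ray_integral G ?g j xu \<partial>(Tp (DIM('a) - j))) = 0" "(\<integral>xu. ray_integral G ?g j xu \<partial>(Tm (DIM('a) - j))) = 0"
        if "j \<in> {1..DIM('a)}" for j
      proof -
        have "DIM('a) - j < DIM('a)" using that by auto
        then show "(\<integral>xu. ray_integral G ?g j xu \<partial>(Tp (DIM('a) - j))) = 0" "(\<integral>xu. ray_integral G ?g j xu \<partial>(Tm (DIM('a) - j))) = 0"
          by (intro integral_eq_zero_AE AE_mp[OF AE_Tp AE_I2] AE_mp[OF AE_Tm AE_I2] impI 0; simp)+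
      qed
      then show "(\<Sum>j = 1..DIM('a). real ((DIM('a) - 1) choose (j - 1)) *
      ((\<integral>xu. ray_integral G ?g j xu \<partial>(Tp (DIM('a) - j))) - (\<integral>xu. ray_integral G ?g j xu \<partial>(Tm (DIM('a) - j))))) = 0"
        by (intro sum.neutral) auto
    qed (use S in auto)
    also have "(LINT z : (- G) | lborel. ?g z) = (LINT z | lborel. ?g z)"
      unfolding set_lebesgue_integral_def
      by (intro Bochner_Integration.integral_cong) (use disj in \<open>auto simp: indicator_def\<close>)
    finally have "measure lborel ?S = 0" by simp
    \<comment> \<open>The real-valued \<open>measure\<close> also vanishes on sets of infinite mass,
      so finiteness must be supplied before the set is known to be null.\<close>
    moreover have "emeasure lborel ?S < \<infinity>"
      by (rule le_less_trans[OF emeasure_mono[of _ "cball 0 (real n)"]]) (use emeasure_bounded_finite[of "cball 0 (real n) :: 'a set"] in auto)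
    ultimately show ?thesis by (auto simp: measure_def enn2real_eq_0_iff)
  qed
  then have "(\<Union>n. skeleton G \<inter> cball 0 (real n)) \<in> null_sets lborel"
    using skeleton_measurable[OF closed] by (intro null_sets_UN) (auto simp: null_sets_def)
  also have "(\<Union>n. skeleton G \<inter> cball 0 (real n)) = skeleton G"
    by (auto simp: real_arch_simple)
  finally show ?thesis by (rule AE_not_in)
qed


text \<open>\<open>K\<close> is quantified before \<open>e\<close> and \<open>A\<close>, so the
  bound applies to a set that moves with \<open>e\<close>. Uniformity holds because on every ray
  only parameters up to \<open>e * T\<close> can meet \<open>A\<close>, whatever its shape; the rest
  is controlled by the integrals of \<open>h\<close>.\<close>

lemma ray_expansion:
  assumes h: "h \<in> borel_measurable borel"
    and hC: "\<And>xu. xu \<in> Nor G \<Longrightarrow> 0 \<le> h (fst xu) \<and> h (fst xu) \<le> C"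
    and hint: "\<And>i. i < DIM('a) \<Longrightarrow> (\<integral>\<^sup>+ xu. ennreal (h (fst xu)) \<partial>Tp i) < \<infinity> \<and>
        (\<integral>\<^sup>+ xu. ennreal (h (fst xu)) \<partial>Tm i) < \<infinity>"
    and T: "0 < T"
  shows "\<exists>K. \<forall>e A. 0 < e \<and> e \<le> 1 \<and> A \<in> sets borel \<and> bounded A \<and> A - G \<subseteq> {z. infdist z G \<le> e * T} \<longrightarrow>
    ray_mass G (Tp (DIM('a) - 1)) h e A < \<infinity> \<and> proj_mass G h A < \<infinity> \<and>
    \<bar>enn2real (proj_mass G h A) / e - enn2real (ray_mass G (Tp (DIM('a) - 1)) h e A)\<bar> \<le> K * e"
proof -
  define d where "d = DIM('a)"
  have d: "1 \<le> d" unfolding d_def using DIM_positive[where 'a='a] by linarith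
  define I where "I M = (\<integral>xu. \<bar>h (fst xu)\<bar> \<partial>M)" for M :: "('a \<times> 'a) measure"
  \<comment> \<open>Term \<open>j\<close> is at most \<open>(e * T) ^ j\<close> times the integrals
    of \<open>h\<close> against both Jordan parts, and \<open>e ^ j \<le> e\<^sup>2\<close> for
    \<open>j \<ge> 2\<close> and \<open>e \<le> 1\<close>. Factoring out \<open>e\<^sup>2\<close>
    leaves \<open>K\<close>; dividing by \<open>e\<close> turns the error into
    \<open>K * e\<close>.\<close>
  define K where "K = (\<Sum>j = 2..d. real ((d - 1) choose (j - 1)) * (T ^ j * (I (Tp (d - j)) + I (Tm (d - j)))))"
  have hm: "(\<lambda>xu. h (fst xu)) \<in> borel_measurable (borel :: ('a \<times> 'a) measure)"
    by (rule measurable_compose[OF _ h]) (intro borel_measurable_continuous_onI continuous_intros)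
  have int: "integrable M (\<lambda>xu. \<bar>h (fst xu)\<bar>)"
    if M: "sets M = sets borel" "AE xu in M. xu \<in> Nor G" "(\<integral>\<^sup>+ xu. ennreal (h (fst xu)) \<partial>M) < \<infinity>" for M
  proof (rule integrableI_bounded)
    show "(\<lambda>xu. \<bar>h (fst xu)\<bar>) \<in> borel_measurable M"
      using hm by (simp add: measurable_cong_sets[OF M(1)])
    have "(\<integral>\<^sup>+ xu. ennreal (norm \<bar>h (fst xu)\<bar>) \<partial>M) = (\<integral>\<^sup>+ xu. ennreal (h (fst xu)) \<partial>M)"
      by (intro nn_integral_cong_AE AE_mp[OF M(2) AE_I2]) (auto dest: hC)
    with M(3) show "(\<integral>\<^sup>+ xu. ennreal (norm \<bar>h (fst xu)\<bar>) \<partial>M) < \<infinity>" by simp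
  qed
  note intTp = int[OF sets_Tp AE_Tp conjunct1[OF hint]] and intTm = int[OF sets_Tm AE_Tm conjunct2[OF hint]]
  have "ray_mass G (Tp (DIM('a) - 1)) h e A < \<infinity> \<and> proj_mass G h A < \<infinity> \<and>
      \<bar>enn2real (proj_mass G h A) / e - enn2real (ray_mass G (Tp (DIM('a) - 1)) h e A)\<bar> \<le> K * e"
    if e: "0 < e" "e \<le> 1" and A: "A \<in> sets borel" "bounded A" "A - G \<subseteq> {z. infdist z G \<le> e * T}" for e A
  proof -
    define p where "p = (\<lambda>z. if z \<in> skeleton G then 0 else proj G z)"
    \<comment> \<open>Test function for the Steiner formula: \<open>h\<close> at the foot point,
      restricted to \<open>A - G\<close> and made Borel by removing the skeleton. The removed set is
      null and is not met by the rays, so neither side of the formula notices.\<close>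
    define g where "g z = indicator (A - G - skeleton G) z * h (p z)" for z
    define \<phi> where "\<phi> xu = (\<integral>\<^sup>+ s. indicator (ray_set G e A) (s, xu) * ennreal (h (fst xu)) \<partial>lborel)" for xu
    define J where "J M j = (\<integral>xu. ray_integral G g j xu \<partial>M)" for M j
    have pm: "p \<in> borel_measurable borel"
      unfolding p_def by (rule proj_measurable_off_skeleton[OF cl])
    have Ag[measurable]: "A - G - skeleton G \<in> sets borel"
      using A(1) closed skeleton_measurable[OF closed] by auto
    have gm: "g \<in> borel_measurable borel"
      unfolding g_def using measurable_compose[OF pm h] by measurable
    \<comment> \<open>The absolute value covers an empty normal bundle, where nothing forces
      \<open>C\<close> to be nonnegative.\<close>
    have g_bd: "0 \<le> g z \<and> g z \<le> \<bar>C\<bar>" for z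
    proof (cases "z \<in> A - G - skeleton G")
      case True
      then have "(proj G z, unitn G z) \<in> Nor G" by (auto simp: Nor_def)
      from hC[OF this] True show ?thesis by (simp add: g_def p_def)
    qed (simp add: g_def)
    have g_eq: "ennreal (g z) = indicator (A - G) z * ennreal (h (proj G z))" if "z \<notin> skeleton G" for z
      using that by (auto simp: g_def p_def indicator_def)
    have nn_g: "(\<integral>\<^sup>+ z. indicator (A - G) z * ennreal (h (proj G z)) \<partial>lborel) = (\<integral>\<^sup>+ z. ennreal (g z) \<partial>lborel)"
      by (intro nn_integral_cong_AE AE_mp[OF skeleton_null AE_I2]) (simp add: g_eq)
    have g_fin: "(\<integral>\<^sup>+ z. ennreal (g z) \<partial>lborel) < \<infinity>"
    proof -
      have "(\<integral>\<^sup>+ z. ennreal (g z) \<partial>lborel) \<le> (\<integral>\<^sup>+ z. ennreal \<bar>C\<bar> * indicator A z \<partial>lborel)"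
      proof (rule nn_integral_mono)
        fix z
        show "ennreal (g z) \<le> ennreal \<bar>C\<bar> * indicator A z"
        proof (cases "z \<in> A")
          case True
          then show ?thesis using g_bd[of z] by (simp add: ennreal_leI)
        qed (simp add: g_def)
      qed
      also have "\<dots> = ennreal \<bar>C\<bar> * emeasure lborel A"
        using A(1) by (simp add: nn_integral_cmult_indicator)
      also have "\<dots> < \<infinity>"
        using emeasure_bounded_finite[OF A(2)] by (simp add: ennreal_mult_less_top)
      finally show ?thesis .
    qed
    have set_int_g: "(LINT z : (- G) | lborel. g z) = enn2real (\<integral>\<^sup>+ z. ennreal (g z) \<partial>lborel)"
    proof -
      have "(LINT z : (- G) | lborel. g z) = (LINT z | lborel. g z)"
        unfolding set_lebesgue_integral_def
        by (intro Bochner_Integration.integral_cong) (auto simp: g_def indicator_def)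
      also have "\<dots> = enn2real (\<integral>\<^sup>+ z. ennreal (g z) \<partial>lborel)"
        using gm g_bd by (intro integral_eq_nn_integral) auto
      finally show ?thesis .
    qed
    \<comment> \<open>Below the reach the foot point along a ray stays fixed, so \<open>g\<close> is
      the constant \<open>h (fst xu)\<close> wherever the ray meets \<open>A\<close>. The parameter
      equals the distance to \<open>G\<close> and is therefore at most \<open>e * T\<close>.\<close>
    have on_ray: "indicator {t. 0 < t \<and> ereal t < reach G (fst xu) (snd xu)} t * g (fst xu + t *\<^sub>R snd xu) =
        indicator {t. 0 < t \<and> ereal t < reach G (fst xu) (snd xu) \<and> fst xu + t *\<^sub>R snd xu \<in> A} t * h (fst xu)"
      and on_ray_le: "0 < t \<Longrightarrow> ereal t < reach G (fst xu) (snd xu) \<Longrightarrow> fst xu + t *\<^sub>R snd xu \<in> A \<Longrightarrow> t \<le> e * T"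
      if xu: "xu \<in> Nor G" for xu t
    proof -
      have u: "norm (snd xu) = 1" using xu Nor_iff[OF cl, of "fst xu" "snd xu"] by simp
      note ray = reach_gt_imp[OF cl u, of t "fst xu"]
      show "indicator {t. 0 < t \<and> ereal t < reach G (fst xu) (snd xu)} t * g (fst xu + t *\<^sub>R snd xu) =
        indicator {t. 0 < t \<and> ereal t < reach G (fst xu) (snd xu) \<and> fst xu + t *\<^sub>R snd xu \<in> A} t * h (fst xu)"
        using ray by (auto simp: g_def p_def indicator_def)
      show "t \<le> e * T" if t: "0 < t" "ereal t < reach G (fst xu) (snd xu)" "fst xu + t *\<^sub>R snd xu \<in> A"
        using ray(2,5)[OF t(1,2)] t(3) A(3) by auto
    qed
    have ray_val: "ray_integral G g j xu = (\<integral>t. indicator {t. 0 < t \<and> ereal t < reach G (fst xu) (snd xu) \<and>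
        fst xu + t *\<^sub>R snd xu \<in> A} t * h (fst xu) * t ^ (j - 1) \<partial>lborel)" if "xu \<in> Nor G" for xu j
      unfolding ray_integral_Nor[OF that] mult.assoc[symmetric] on_ray[OF that] ..
    \<comment> \<open>One factor \<open>e * T\<close> is the length of the interval of parameters,
      the other \<open>j - 1\<close> factors bound \<open>t ^ (j - 1)\<close>.\<close>
    have ray_bd: "\<bar>ray_integral G g j xu\<bar> \<le> (e * T) ^ j * \<bar>h (fst xu)\<bar>" if xu: "xu \<in> Nor G" and j: "1 \<le> j" for xu j
    proof -
      have "norm (ray_integral G g j xu) \<le> (\<integral>t. indicator {0..e * T} t * (\<bar>h (fst xu)\<bar> * (e * T) ^ (j - 1)) \<partial>lborel)"
        unfolding ray_val[OF xu]
      proof (rule order_trans[OF integral_norm_bound integral_mono'])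
        show "norm (indicator {t. 0 < t \<and> ereal t < reach G (fst xu) (snd xu) \<and>
            fst xu + t *\<^sub>R snd xu \<in> A} t * h (fst xu) * t ^ (j - 1)) \<le> indicator {0..e * T} t * (\<bar>h (fst xu)\<bar> * (e * T) ^ (j - 1))"
          for t :: real
          using on_ray_le[OF xu, of t]
          by (auto simp: indicator_def abs_mult power_abs intro!: mult_left_mono power_mono)
      qed (use e T in \<open>auto intro!: mult_nonneg_nonneg\<close>)
      also have "\<dots> = (e * T) * (\<bar>h (fst xu)\<bar> * (e * T) ^ (j - 1))"
        using e T by simp
      also have "\<dots> = (e * T) ^ j * \<bar>h (fst xu)\<bar>" using j by (cases j) auto
      finally show ?thesis by simp
    qed
    have J_bd: "\<bar>J M j\<bar> \<le> (e * T) ^ j * I M"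
      if "AE xu in M. xu \<in> Nor G" "integrable M (\<lambda>xu. \<bar>h (fst xu)\<bar>)" "1 \<le> j" for M j
    proof -
      have "\<bar>J M j\<bar> \<le> (\<integral>xu. \<bar>ray_integral G g j xu\<bar> \<partial>M)"
        unfolding J_def using integral_norm_bound[of M "ray_integral G g j"] by simp
      also have "\<dots> \<le> (\<integral>xu. (e * T) ^ j * \<bar>h (fst xu)\<bar> \<partial>M)"
        using that e T by (intro integral_mono_AE' AE_mp[OF that(1) AE_I2]) (auto simp: ray_bd)
      also have "\<dots> = (e * T) ^ j * I M" by (simp add: I_def)
      finally show ?thesis .
    qed
    have W[measurable]: "ray_set G e A \<in> sets borel" by (rule ray_set_measurable[OF cl A(1)])
    have ray1: "ennreal (ray_integral G g 1 xu) = ennreal e * \<phi> xu" "0 \<le> ray_integral G g 1 xu" if xu: "xu \<in> Nor G" for xu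
    proof -
      let ?S = "{t. 0 < t \<and> ereal t < reach G (fst xu) (snd xu) \<and> fst xu + t *\<^sub>R snd xu \<in> A}"
      have "(\<lambda>t. fst xu + t *\<^sub>R snd xu) \<in> borel_measurable borel"
        by (intro borel_measurable_continuous_onI continuous_intros)
      note [measurable] = this A(1)
      have S: "?S \<in> sets borel" by measurable
      have "emeasure lborel ?S \<le> emeasure lborel {0..e * T}"
        using on_ray_le[OF xu] by (intro emeasure_mono) auto
      also have "\<dots> < \<infinity>" by (intro emeasure_bounded_finite) simp
      finally have fin: "emeasure lborel ?S < \<infinity>" .
      have eq: "ray_integral G g 1 xu = (\<integral>t. indicator ?S t * h (fst xu) \<partial>lborel)"
        unfolding ray_val[OF xu] by simp
      show "0 \<le> ray_integral G g 1 xu" unfolding eq using hC[OF xu] by (intro integral_nonneg_AE) auto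
      have "ennreal (ray_integral G g 1 xu) = (\<integral>\<^sup>+ t. ennreal (indicator ?S t * h (fst xu)) \<partial>lborel)"
        unfolding eq using hC[OF xu] S fin
        by (intro nn_integral_eq_integral[symmetric] integrable_mult_left) auto
      also have "\<dots> = ennreal \<bar>e\<bar> * (\<integral>\<^sup>+ s. ennreal (indicator ?S (0 + e * s) * h (fst xu)) \<partial>lborel)"
        using e S by (intro nn_integral_real_affine) auto
      also have "(\<integral>\<^sup>+ s. ennreal (indicator ?S (0 + e * s) * h (fst xu)) \<partial>lborel) = \<phi> xu"
        unfolding \<phi>_def using xu e by (intro nn_integral_cong) (auto simp: ray_set_def indicator_def zero_less_mult_iff)
      finally show "ennreal (ray_integral G g 1 xu) = ennreal e * \<phi> xu" using e by simp
    qed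
    have top: "DIM('a) - 1 < DIM('a)" by simp
    note AE1 = AE_Tp[OF top]
    have rm: "ray_integral G g j \<in> borel_measurable (Tp (DIM('a) - 1))" for j
      using ray_integral_measurable[OF cl gm] by (simp only: measurable_cong_sets[OF sets_Tp[OF top] refl])
    have Jtop: "ennreal (J (Tp (DIM('a) - 1)) 1) = ennreal e * (\<integral>\<^sup>+ xu. \<phi> xu \<partial>Tp (DIM('a) - 1))"
    proof -
      have i: "integrable (Tp (DIM('a) - 1)) (ray_integral G g 1)"
      proof (rule Bochner_Integration.integrable_bound[OF _ rm])
        show "integrable (Tp (DIM('a) - 1)) (\<lambda>xu. (e * T) * \<bar>h (fst xu)\<bar>)"
          using intTp[OF top top top] by (rule integrable_mult_right)
        show "AE xu in Tp (DIM('a) - 1). norm (ray_integral G g 1 xu) \<le> norm ((e * T) * \<bar>h (fst xu)\<bar>)"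
          using ray_bd[of _ 1] e T by (intro AE_mp[OF AE1 AE_I2] impI) (simp add: abs_mult)
      qed
      have "ennreal (J (Tp (DIM('a) - 1)) 1) = (\<integral>\<^sup>+ xu. ennreal (ray_integral G g 1 xu) \<partial>Tp (DIM('a) - 1))"
        unfolding J_def by (intro nn_integral_eq_integral[symmetric] i AE_mp[OF AE1 AE_I2] impI ray1)
      also have "\<dots> = (\<integral>\<^sup>+ xu. ennreal e * \<phi> xu \<partial>Tp (DIM('a) - 1))"
        by (intro nn_integral_cong_AE AE_mp[OF AE1 AE_I2] impI ray1)
      also have "\<dots> = ennreal e * (\<integral>\<^sup>+ xu. \<phi> xu \<partial>Tp (DIM('a) - 1))"
      proof (rule nn_integral_cmult)
        have "(\<lambda>(xu, s). indicator (ray_set G e A) (s, xu) * ennreal (h (fst xu))) \<in>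
           borel_measurable (borel \<Otimes>\<^sub>M lborel)"
        proof -
          have "(\<lambda>(xu, s). (s, xu)) \<in> (borel :: ('a \<times> 'a) measure) \<Otimes>\<^sub>M (lborel :: real measure) \<rightarrow>\<^sub>M borel \<Otimes>\<^sub>M borel"
            by (simp add: split_beta')
          then have "(\<lambda>p. (snd p, fst p)) \<in> (borel :: ('a \<times> 'a) measure) \<Otimes>\<^sub>M (lborel :: real measure) \<rightarrow>\<^sub>M borel"
            by (simp add: borel_prod split_beta')
          moreover have "(\<lambda>p. h (fst (fst p))) \<in> borel_measurable ((borel :: ('a \<times> 'a) measure) \<Otimes>\<^sub>M (lborel :: real measure))"
            by (rule measurable_compose[OF measurable_fst hm])
          ultimately show ?thesis unfolding split_beta' by measurable
        qed
        from lborel.borel_measurable_nn_integral[OF this]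
        show "\<phi> \<in> borel_measurable (Tp (DIM('a) - 1))"
          by (simp only: measurable_cong_sets[OF sets_Tp[OF top] refl] \<phi>_def[abs_def])
      qed
      finally show ?thesis .
    qed
    \<comment> \<open>The left side of \<open>Jtop\<close> is a real number, so its right side
      cannot be infinite. This is why that identity was stated in \<open>ennreal\<close>
      first.\<close>
    have fin\<phi>: "(\<integral>\<^sup>+ xu. \<phi> xu \<partial>Tp (DIM('a) - 1)) < \<infinity>"
    proof (rule ccontr)
      assume "\<not> ?thesis"
      then have "(\<integral>\<^sup>+ xu. \<phi> xu \<partial>Tp (DIM('a) - 1)) = \<infinity>" by (simp add: less_top[symmetric])
      then show False using Jtop e by (simp add: ennreal_mult_top)
    qed
    have J1: "J (Tp (DIM('a) - 1)) 1 = e * enn2real (\<integral>\<^sup>+ xu. \<phi> xu \<partial>Tp (DIM('a) - 1))"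
    proof -
      have "0 \<le> J (Tp (DIM('a) - 1)) 1"
        unfolding J_def by (intro integral_nonneg_AE AE_mp[OF AE1 AE_I2] impI ray1)
      then have "J (Tp (DIM('a) - 1)) 1 = enn2real (ennreal e * (\<integral>\<^sup>+ xu. \<phi> xu \<partial>Tp (DIM('a) - 1)))"
        by (simp only: Jtop[symmetric] enn2real_ennreal)
      then show ?thesis using e by (simp add: enn2real_mult)
    qed
    have Jm: "J (Tm (DIM('a) - 1)) 1 = 0"
      unfolding J_def by (intro integral_eq_zero_AE AE_Tm_top)
    have "compact (closure A)" using A(2) by (simp add: compact_closure)
    moreover have "g z = 0" if "z \<notin> closure A" for z
      using that closure_subset[of A] by (auto simp: g_def indicator_def)
    moreover have "bounded (range g)" by (rule boundedI[of _ "\<bar>C\<bar>"]) (use g_bd in auto)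
    ultimately have "(LINT z : (- G) | lborel. g z) =
      (\<Sum>j = 1..d. real ((d - 1) choose (j - 1)) * (J (Tp (d - j)) j - J (Tm (d - j)) j))"
      using steiner[OF gm, of "closure A"] unfolding J_def d_def by blast
    also have "\<dots> = e * enn2real (\<integral>\<^sup>+ xu. \<phi> xu \<partial>Tp (DIM('a) - 1)) +
      (\<Sum>j = 2..d. real ((d - 1) choose (j - 1)) * (J (Tp (d - j)) j - J (Tm (d - j)) j))"
      unfolding sum.atLeast_Suc_atMost[OF d] using J1 Jm by (simp add: d_def numeral_2_eq_2)
    finally have "enn2real (\<integral>\<^sup>+ z. ennreal (g z) \<partial>lborel) - e * enn2real (\<integral>\<^sup>+ xu. \<phi> xu \<partial>Tp (DIM('a) - 1)) =
      (\<Sum>j = 2..d. real ((d - 1) choose (j - 1)) * (J (Tp (d - j)) j - J (Tm (d - j)) j))"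
      unfolding set_int_g by simp
    also have "\<bar>\<dots>\<bar> \<le> (\<Sum>j = 2..d. \<bar>real ((d - 1) choose (j - 1)) * (J (Tp (d - j)) j - J (Tm (d - j)) j)\<bar>)"
      by (rule sum_abs)
    also have "\<dots> \<le> (\<Sum>j = 2..d. e\<^sup>2 * (real ((d - 1) choose (j - 1)) * (T ^ j * (I (Tp (d - j)) + I (Tm (d - j))))))"
    proof (rule sum_mono)
      fix j assume j: "j \<in> {2..d}"
      then have dj: "d - j < DIM('a)" and j1: "1 \<le> j" by (auto simp: d_def)
      have Inn: "0 \<le> I M" for M unfolding I_def by simp
      have "\<bar>J (Tp (d - j)) j - J (Tm (d - j)) j\<bar> \<le> (e * T) ^ j * (I (Tp (d - j)) + I (Tm (d - j)))"
        using J_bd[OF AE_Tp[OF dj] intTp[OF dj dj dj] j1] J_bd[OF AE_Tm[OF dj] intTm[OF dj dj dj] j1]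
        unfolding distrib_left by linarith
      also have "\<dots> = e ^ j * (T ^ j * (I (Tp (d - j)) + I (Tm (d - j))))" by (simp add: power_mult_distrib)
      also have "\<dots> \<le> e\<^sup>2 * (T ^ j * (I (Tp (d - j)) + I (Tm (d - j))))"
        using e j T Inn by (intro mult_right_mono power_decreasing mult_nonneg_nonneg add_nonneg_nonneg) auto
      finally show "\<bar>real ((d - 1) choose (j - 1)) * (J (Tp (d - j)) j - J (Tm (d - j)) j)\<bar> \<le>
          e\<^sup>2 * (real ((d - 1) choose (j - 1)) * (T ^ j * (I (Tp (d - j)) + I (Tm (d - j)))))"
        unfolding abs_mult mult.left_commute[of "e\<^sup>2"] by (intro mult_mono) auto
    qed
    also have "\<dots> = e\<^sup>2 * K" by (simp add: K_def sum_distrib_left)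
    finally have fin: "\<bar>enn2real (\<integral>\<^sup>+ z. ennreal (g z) \<partial>lborel) - e * enn2real (\<integral>\<^sup>+ xu. \<phi> xu \<partial>Tp (DIM('a) - 1))\<bar> \<le> e\<^sup>2 * K" .
    have "enn2real (\<integral>\<^sup>+ z. ennreal (g z) \<partial>lborel) / e - enn2real (\<integral>\<^sup>+ xu. \<phi> xu \<partial>Tp (DIM('a) - 1)) =
      (enn2real (\<integral>\<^sup>+ z. ennreal (g z) \<partial>lborel) - e * enn2real (\<integral>\<^sup>+ xu. \<phi> xu \<partial>Tp (DIM('a) - 1))) / e"
      using e by (simp add: field_simps)
    also have "\<bar>\<dots>\<bar> \<le> (e\<^sup>2 * K) / e"
      unfolding abs_divide using fin e by (simp add: divide_right_mono)
    also have "\<dots> = K * e" using e by (simp add: power2_eq_square)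
    finally show ?thesis
      unfolding proj_mass_def ray_mass_def nn_g \<phi>_def[symmetric] using g_fin fin\<phi> by blast
  qed
  then show ?thesis by blast
qed

end

section \<open>Magnification\<close>

text \<open>Two one-sided estimates replace a subtraction, which is badly behaved in
  \<open>ennreal\<close>. Finiteness of \<open>a\<close> is a conclusion, so the lemma can be
  applied to a quantity not yet known to be finite.\<close>

lemma enn2real_dist_le:
  fixes a b c :: ennreal
  assumes "a \<le> b + c" "b \<le> a + c" "b < \<infinity>" "c < \<infinity>"
  shows "a < \<infinity>" "\<bar>enn2real a - enn2real b\<bar> \<le> enn2real c"
proof -
  have "b + c < \<infinity>" using assms(3,4) by (simp add: ennreal_add_less_top less_top[symmetric])
  then show a: "a < \<infinity>" using assms(1) by (rule le_less_trans[rotated])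
  show "\<bar>enn2real a - enn2real b\<bar> \<le> enn2real c"
    using a assms by (cases a; cases b; cases c) (auto simp flip: ennreal_plus)
qed

text \<open>\<open>Te\<close> is specified by its values on Borel subsets of the two sheets of the
  bundle. Restricting both measures through the density \<open>indicator S\<close> turns agreement
  on subsets into equality of measures, and hence of integrals.\<close>

lemma nn_integral_indicator_cong_measure:
  assumes "sets M = sets N" "S \<in> sets M"
    and eq: "\<And>A. A \<in> sets M \<Longrightarrow> A \<subseteq> S \<Longrightarrow> emeasure M A = emeasure N A"
    and g: "g \<in> borel_measurable M"
  shows "(\<integral>\<^sup>+ x. indicator S x * g x \<partial>M) = (\<integral>\<^sup>+ x. indicator S x * g x \<partial>N)"
proof -
  have S: "S \<in> sets M" "S \<in> sets N" using assms(1,2) by auto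
  have "density M (indicator S) = density N (indicator S)"
  proof (rule measure_eqI)
    fix A assume "A \<in> sets (density M (indicator S))"
    then have A: "A \<in> sets M" "A \<in> sets N" using assms(1) by auto
    have "emeasure (density M (indicator S)) A = emeasure M (S \<inter> A)"
      using A S by (simp add: emeasure_density indicator_inter_arith[symmetric])
    also have "\<dots> = emeasure N (S \<inter> A)" using A S by (intro eq) auto
    also have "\<dots> = emeasure (density N (indicator S)) A"
      using A S by (simp add: emeasure_density indicator_inter_arith[symmetric])
    finally show "emeasure (density M (indicator S)) A = emeasure (density N (indicator S)) A" .
  qed (simp add: assms(1))
  then have "integral\<^sup>N (density M (indicator S)) g = integral\<^sup>N (density N (indicator S)) g" by simp
  moreover have "g \<in> borel_measurable N" using g by (simp add: measurable_cong_sets[OF assms(1)])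
  ultimately show ?thesis using g S by (simp add: nn_integral_density)
qed

text \<open>For fixed \<open>y\<close> the equation determines \<open>s\<close>, because
  \<open>c \<noteq> 0\<close>; each section has at most one point and is Lebesgue null. In the
  application \<open>c\<close> is \<open>e\<close> or \<open>- e\<close> and \<rho> is a reach
  function.\<close>

lemma null_sets_graph:
  fixes c :: real and \<rho> :: "'b::euclidean_space \<Rightarrow> ereal"
  assumes T: "sigma_finite_measure N" "sets N = sets borel"
    and \<rho>: "\<rho> \<in> borel_measurable borel" and c: "c \<noteq> 0"
  shows "{p. ereal (c * fst p) = \<rho> (snd p)} \<in> null_sets (lborel \<Otimes>\<^sub>M N)"
proof -
  interpret N: sigma_finite_measure N by fact
  interpret pair_sigma_finite lborel N ..
  have [measurable]: "\<rho> \<in> borel_measurable N" using \<rho> by (simp add: measurable_cong_sets[OF T(2)])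
  have sp: "space N = UNIV" using sets_eq_imp_space_eq[OF T(2)] by simp
  have "{p \<in> space (lborel \<Otimes>\<^sub>M N). ereal (c * fst p) = \<rho> (snd p)} \<in> sets (lborel \<Otimes>\<^sub>M N)"
    by measurable
  then have S: "{p. ereal (c * fst p) = \<rho> (snd p)} \<in> sets (lborel \<Otimes>\<^sub>M N)"
    by (simp add: space_pair_measure sp)
  have "emeasure lborel ((\<lambda>s. (s, y)) -` {p. ereal (c * fst p) = \<rho> (snd p)}) = 0" for y
  proof -
    have "(\<lambda>s. (s, y)) -` {p. ereal (c * fst p) = \<rho> (snd p)} \<subseteq> {real_of_ereal (\<rho> y) / c}"
    proof
      fix s assume "s \<in> (\<lambda>s. (s, y)) -` {p. ereal (c * fst p) = \<rho> (snd p)}"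
      then have "\<rho> y = ereal (c * s)" by simp
      then have "real_of_ereal (\<rho> y) / c = s" using c by simp
      then show "s \<in> {real_of_ereal (\<rho> y) / c}" by simp
    qed
    then show ?thesis by (meson countable_subset countable_finite finite.intros emeasure_lborel_countable)
  qed
  then show ?thesis using S by (intro null_setsI) (simp_all add: emeasure_pair_measure_alt2)
qed

text \<open>The second alternative is the case in which \<open>z\<close> sits exactly at the end of
  its ray, a point that \<open>ray_set\<close> excludes.\<close>

lemma ray_set_of_notin:
  fixes G :: "'a::euclidean_space set"
  assumes cl: "closed G" "G \<noteq> {}" and z: "z \<in> A" "z \<notin> skeleton G" "z \<notin> G" and e: "0 < e"
  shows "(infdist z G / e, proj G z, unitn G z) \<in> ray_set G e A \<or>
    ereal (infdist z G) = reach G (proj G z) (unitn G z)"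
proof -
  note nd = notin_decompose[OF cl z(2,3)]
  have "(proj G z, unitn G z) \<in> Nor G" using z by (auto simp: Nor_def)
  then show ?thesis
    using nd(1,4) e z(1) unfolding ray_set_def nd(2)[symmetric]
    by (simp add: nd(2)[symmetric] order_le_less)
qed

lemma ray_set_imp:
  fixes G :: "'a::euclidean_space set"
  assumes cl: "closed G" "G \<noteq> {}" and e: "0 < e" and s: "(s, x, u) \<in> ray_set G e A"
  obtains z where "z \<in> A" "z \<notin> G" "z \<notin> skeleton G" "infdist z G = e * s" "proj G z = x" "unitn G z = u"
proof -
  have *: "norm u = 1" "0 < e * s" "ereal (e * s) < reach G x u" "x + (e * s) *\<^sub>R u \<in> A"
    using s e Nor_iff[OF cl] by (auto simp: ray_set_def)
  show thesis using reach_gt_imp[OF cl *(1-3)] *(4) that by blast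
qed

lemma co_eq: "co F = - interior F"
  by (simp add: co_def closure_complement)

text \<open>The inner layer in outward coordinates: height and normal change sign, as in the inner
  branch of \<open>tau\<close>.\<close>

definition ray_set_neg :: "'a::euclidean_space set \<Rightarrow> real \<Rightarrow> 'a set \<Rightarrow> (real \<times> 'a \<times> 'a) set" where
  "ray_set_neg F e A = {(s, x, u). (- s, x, - u) \<in> ray_set (co F) e A}"

text \<open>A point off \<open>frontier F\<close> is missing from exactly one of \<open>F\<close>
  and \<open>co F\<close>, and its image under \<open>tau\<close> lists its polar coordinates with
  respect to that set. Only the ends of rays can therefore separate the magnified set from the sets
  of rays.\<close>

lemma tau_img_bounds:
  fixes F :: "'a::euclidean_space set"
  assumes F: "closed F" "F \<noteq> {}" "co F \<noteq> {}" and e: "0 < e"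
  shows "ray_set F e A \<union> ray_set_neg F e A \<subseteq> tau_img F e A"
    and "tau_img F e A \<subseteq> ray_set F e A \<union> ray_set_neg F e A \<union>
      ({p. ereal (e * fst p) = reach F (fst (snd p)) (snd (snd p))} \<union>
       {p. ereal (- e * fst p) = reach (co F) (fst (snd p)) (- snd (snd p))})"
proof -
  have coF: "closed (co F)" by (simp add: co_def)
  have fr: "frontier F = F \<inter> co F" using F(1) by (simp add: frontier_closures co_def)
  show "ray_set F e A \<union> ray_set_neg F e A \<subseteq> tau_img F e A"
  proof (intro subsetI; clarify)
    fix s x u assume "(s, x, u) \<in> ray_set F e A \<union> ray_set_neg F e A"
    then show "(s, x, u) \<in> tau_img F e A"
    proof
      assume "(s, x, u) \<in> ray_set F e A"
      from ray_set_imp[OF F(1,2) e this] obtain z where z: "z \<in> A" "z \<notin> F" "z \<notin> skeleton F"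
        "infdist z F = e * s" "proj F z = x" "unitn F z = u" .
      \<comment> \<open>A point off \<open>F\<close> lies in \<open>co F\<close>, and no set meets
        its own skeleton; so the skeleton of \<open>co F\<close> is avoided as well.\<close>
      have "z \<in> co F" using z(2) closure_subset[of "- F"] by (auto simp: co_def)
      then have "z \<in> A - (frontier F \<union> skeleton F \<union> skeleton (co F))"
        using z skeleton_disjoint[of "co F"] by (auto simp: fr)
      moreover have "tau F e z = (s, x, u)" using z e by (simp add: tau_def dist_set_def)
      ultimately show ?thesis unfolding tau_img_def by force
    next
      assume "(s, x, u) \<in> ray_set_neg F e A"
      then have "(- s, x, - u) \<in> ray_set (co F) e A" by (simp add: ray_set_neg_def)
      from ray_set_imp[OF coF F(3) e this] obtain z where z: "z \<in> A" "z \<notin> co F" "z \<notin> skeleton (co F)"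
        "infdist z (co F) = e * - s" "proj (co F) z = x" "unitn (co F) z = - u" .
      have "z \<in> F" using z(2) interior_subset[of F] by (auto simp: co_eq)
      then have "z \<in> A - (frontier F \<union> skeleton F \<union> skeleton (co F))"
        using z skeleton_disjoint[of F] by (auto simp: fr)
      moreover have "tau F e z = (s, x, u)" using z e \<open>z \<in> F\<close> by (simp add: tau_def dist_set_def)
      ultimately show ?thesis unfolding tau_img_def by force
    qed
  qed
  show "tau_img F e A \<subseteq> ray_set F e A \<union> ray_set_neg F e A \<union>
      ({p. ereal (e * fst p) = reach F (fst (snd p)) (snd (snd p))} \<union>
       {p. ereal (- e * fst p) = reach (co F) (fst (snd p)) (- snd (snd p))})"
  proof
    fix p assume "p \<in> tau_img F e A"
    then obtain z where z: "p = tau F e z" "z \<in> A" "z \<notin> frontier F" "z \<notin> skeleton F" "z \<notin> skeleton (co F)"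
      by (auto simp: tau_img_def)
    show "p \<in> ray_set F e A \<union> ray_set_neg F e A \<union>
      ({p. ereal (e * fst p) = reach F (fst (snd p)) (snd (snd p))} \<union>
       {p. ereal (- e * fst p) = reach (co F) (fst (snd p)) (- snd (snd p))})"
    proof (cases "z \<in> F")
      case False
      then show ?thesis
        using ray_set_of_notin[OF F(1,2) z(2,4) False e] e by (auto simp: z(1) tau_def dist_set_def)
    next
      case True
      then have "z \<notin> co F" using z(3) fr by auto
      with True show ?thesis
        using ray_set_of_notin[OF coF F(3) z(2,5) _ e] e
        by (auto simp: z(1) tau_def dist_set_def ray_set_neg_def)
    qed
  qed
qed

section \<open>Finite mass of level sets and the limit on one side of the boundary\<close>

context support_measure_pair begin

text \<open>Markov's inequality: at the top index the exponent is 1, and on \<open>S\<close> the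
  reach truncated at 1 is at least \<open>min r 1\<close>. The integrability condition over a closed
  ball with \<open>c = 1\<close> therefore bounds the mass of \<open>S\<close>.\<close>

lemma level_set_finite:
  fixes R :: real
  assumes r: "0 < r"
  defines "S \<equiv> {xu \<in> Nor G. norm (fst xu) \<le> R \<and> ereal r \<le> reach G (fst xu) (snd xu)}"
  shows "S \<in> sets borel" "emeasure (Tp (DIM('a) - 1)) S < \<infinity>"
proof -
  have top: "DIM('a) - 1 < DIM('a)" by simp
  note [measurable] = reach_measurable[OF cl] Nor_measurable[OF cl]
  have [measurable]: "(\<lambda>xu::'a \<times> 'a. norm (fst xu)) \<in> borel_measurable borel"
    by (intro borel_measurable_continuous_onI continuous_intros)
  have "{xu \<in> space borel. xu \<in> Nor G \<and> norm (fst xu) \<le> R \<and> ereal r \<le> reach G (fst xu) (snd xu)} \<in> sets borel"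
    by measurable
  then show S: "S \<in> sets borel" by (simp add: S_def)
  define m where "m = min r 1"
  have m: "0 < m" using r by (simp add: m_def)
  have "ennreal m * emeasure (Tp (DIM('a) - 1)) S = (\<integral>\<^sup>+ xu. ennreal m * indicator S xu \<partial>Tp (DIM('a) - 1))"
    using S sets_Tp[OF top] by (simp add: nn_integral_cmult_indicator)
  also have "\<dots> \<le> (\<integral>\<^sup>+ xu. indicator (cball 0 R) (fst xu) *
      ennreal (real_of_ereal (min (reach G (fst xu) (snd xu)) (ereal 1)) ^ (DIM('a) - (DIM('a) - 1))) \<partial>Tp (DIM('a) - 1))"
  proof (rule nn_integral_mono)
    fix xu
    show "ennreal m * indicator S xu \<le> indicator (cball 0 R) (fst xu) *
      ennreal (real_of_ereal (min (reach G (fst xu) (snd xu)) (ereal 1)) ^ (DIM('a) - (DIM('a) - 1)))"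
    proof (cases "xu \<in> S")
      case True
      then have *: "ereal m \<le> min (reach G (fst xu) (snd xu)) (ereal 1)"
        by (auto simp: S_def m_def intro: order_trans[of _ "ereal r"])
      moreover have "min (reach G (fst xu) (snd xu)) (ereal 1) \<le> ereal 1" by simp
      ultimately have "m \<le> real_of_ereal (min (reach G (fst xu) (snd xu)) (ereal 1))"
        by (cases "min (reach G (fst xu) (snd xu)) (ereal 1)") auto
      moreover have "DIM('a) - (DIM('a) - 1) = 1" using DIM_positive[where 'a='a] by linarith
      ultimately show ?thesis using True by (simp add: S_def ennreal_leI)
    qed simp
  qed
  also have "\<dots> < \<infinity>"
  proof -
    have "\<forall>K c. compact K \<and> c > 0 \<longrightarrow>
           (\<integral>\<^sup>+ xu. indicator K (fst xu) *
               ennreal (real_of_ereal (min (reach G (fst xu) (snd xu)) (ereal c)) ^ (DIM('a) - (DIM('a) - 1)))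
             \<partial>(Tp (DIM('a) - 1))) < \<infinity>"
      using support top unfolding support_measures_def by blast
    from this[rule_format, of "cball 0 R" 1] show ?thesis by simp
  qed
  finally have "ennreal m * emeasure (Tp (DIM('a) - 1)) S < \<infinity>" .
  then show "emeasure (Tp (DIM('a) - 1)) S < \<infinity>"
    using m unfolding infinity_ennreal_def ennreal_mult_less_top by auto
qed

lemma Nor_eq_UN_level_sets:
  "Nor G = (\<Union>n. {xu \<in> Nor G. norm (fst xu) \<le> real n \<and> ereal (inverse (real (Suc n))) \<le> reach G (fst xu) (snd xu)})"
proof (intro equalityI subsetI)
  fix xu assume xu: "xu \<in> Nor G"
  then have "0 < reach G (fst xu) (snd xu)" using Nor_iff[OF cl, of "fst xu" "snd xu"] by simp
  then obtain n where n: "ereal (inverse (real (Suc n))) \<le> reach G (fst xu) (snd xu)"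
    using ereal_pos_iff_ge_inverse by blast
  obtain m where m: "norm (fst xu) \<le> real m" using real_arch_simple by blast
  have "ereal (inverse (real (Suc (max m n)))) \<le> ereal (inverse (real (Suc n)))"
    by (simp add: le_imp_inverse_le)
  then have "ereal (inverse (real (Suc (max m n)))) \<le> reach G (fst xu) (snd xu)" using n by (rule order_trans)
  moreover have "norm (fst xu) \<le> real (max m n)" using m by simp
  ultimately show "xu \<in> (\<Union>n. {xu \<in> Nor G. norm (fst xu) \<le> real n \<and> ereal (inverse (real (Suc n))) \<le> reach G (fst xu) (snd xu)})"
    using xu by blast
qed auto

text \<open>All of \<open>A - G\<close> lies in the layer over which \<open>boundary_error\<close>
  integrates the pointwise difference of the two densities. The error thus depends on
  \<open>A\<close> only through the width \<open>r\<close>.\<close>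

lemma density_compare:
  fixes f h :: "'a \<Rightarrow> real"
  assumes f: "f \<in> borel_measurable borel" "\<And>z. 0 \<le> f z" and h: "h \<in> borel_measurable borel"
    and h0: "\<And>xu. xu \<in> Nor G \<Longrightarrow> 0 \<le> h (fst xu)"
    and A: "A \<in> sets borel" "A - G \<subseteq> {z. infdist z G \<le> r}"
    and fin: "proj_mass G h A < \<infinity>" "boundary_error G f h r < \<infinity>"
  shows "(\<integral>\<^sup>+ z. indicator (A - G) z * ennreal (f z) \<partial>lborel) < \<infinity>"
    "\<bar>enn2real (\<integral>\<^sup>+ z. indicator (A - G) z * ennreal (f z) \<partial>lborel) - enn2real (proj_mass G h A)\<bar> \<le>
     enn2real (boundary_error G f h r)"
proof -
  define p where "p = (\<lambda>z. if z \<in> skeleton G then 0 else proj G z)"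
  have [measurable]: "p \<in> borel_measurable borel"
    unfolding p_def by (rule proj_measurable_off_skeleton[OF cl])
  note f(1)[measurable] h[measurable]
  have [measurable]: "A - G \<in> sets borel" using A(1) closed by auto
  define D where "D = {z. 0 < dist_set G z \<and> dist_set G z \<le> r}"
  have "{z \<in> space borel. 0 < infdist z G \<and> infdist z G \<le> r} \<in> sets borel"
    by (intro sets.sets_Collect_conj borel_measurable_less borel_measurable_le borel_measurable_const
        borel_measurable_continuous_onI continuous_intros)
  then have [measurable]: "D \<in> sets borel" by (simp add: D_def dist_set_def)
  have h_eq: "proj_mass G h A =
      (\<integral>\<^sup>+ z. indicator (A - G) z * ennreal (h (p z)) \<partial>lborel)"
    unfolding proj_mass_def boundary_error_def D_def
    by (intro nn_integral_cong_AE AE_mp[OF skeleton_null AE_I2]) (simp add: p_def)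
  have d_eq: "boundary_error G f h r =
      (\<integral>\<^sup>+ z. indicator D z * ennreal \<bar>f z - h (p z)\<bar> \<partial>lborel)"
    unfolding proj_mass_def boundary_error_def D_def
    by (intro nn_integral_cong_AE AE_mp[OF skeleton_null AE_I2]) (simp add: p_def)
  have pt: "indicator (A - G) z * ennreal (f z) \<le>
        indicator (A - G) z * ennreal (h (p z)) + indicator D z * ennreal \<bar>f z - h (p z)\<bar> \<and>
      indicator (A - G) z * ennreal (h (p z)) \<le>
        indicator (A - G) z * ennreal (f z) + indicator D z * ennreal \<bar>f z - h (p z)\<bar>"
    if "z \<notin> skeleton G" for z
  proof (cases "z \<in> A - G")
    case True
    then have "(proj G z, unitn G z) \<in> Nor G" using that by (auto simp: Nor_def)
    from h0[OF this] that have "0 \<le> h (p z)" by (simp add: p_def)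
    moreover have "z \<in> D"
      using True A(2) infdist_pos_of_notin[OF cl, of z] by (auto simp: D_def dist_set_def)
    ultimately show ?thesis
      using True f(2)[of z] by (auto simp flip: ennreal_plus intro!: ennreal_leI)
  qed simp
  have "(\<integral>\<^sup>+ z. indicator (A - G) z * ennreal (f z) \<partial>lborel) \<le>
    (\<integral>\<^sup>+ z. indicator (A - G) z * ennreal (h (p z)) + indicator D z * ennreal \<bar>f z - h (p z)\<bar> \<partial>lborel)"
    by (intro nn_integral_mono_AE AE_mp[OF skeleton_null AE_I2]) (simp add: pt)
  also have "\<dots> = (\<integral>\<^sup>+ z. indicator (A - G) z * ennreal (h (p z)) \<partial>lborel) +
      (\<integral>\<^sup>+ z. indicator D z * ennreal \<bar>f z - h (p z)\<bar> \<partial>lborel)"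
    by (intro nn_integral_add) measurable
  finally have 1: "(\<integral>\<^sup>+ z. indicator (A - G) z * ennreal (f z) \<partial>lborel) \<le>
    (\<integral>\<^sup>+ z. indicator (A - G) z * ennreal (h (p z)) \<partial>lborel) +
      (\<integral>\<^sup>+ z. indicator D z * ennreal \<bar>f z - h (p z)\<bar> \<partial>lborel)" .
  have "(\<integral>\<^sup>+ z. indicator (A - G) z * ennreal (h (p z)) \<partial>lborel) \<le>
    (\<integral>\<^sup>+ z. indicator (A - G) z * ennreal (f z) + indicator D z * ennreal \<bar>f z - h (p z)\<bar> \<partial>lborel)"
    by (intro nn_integral_mono_AE AE_mp[OF skeleton_null AE_I2]) (simp add: pt)
  also have "\<dots> = (\<integral>\<^sup>+ z. indicator (A - G) z * ennreal (f z) \<partial>lborel) +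
      (\<integral>\<^sup>+ z. indicator D z * ennreal \<bar>f z - h (p z)\<bar> \<partial>lborel)"
    by (intro nn_integral_add) measurable
  finally have 2: "(\<integral>\<^sup>+ z. indicator (A - G) z * ennreal (h (p z)) \<partial>lborel) \<le>
    (\<integral>\<^sup>+ z. indicator (A - G) z * ennreal (f z) \<partial>lborel) +
      (\<integral>\<^sup>+ z. indicator D z * ennreal \<bar>f z - h (p z)\<bar> \<partial>lborel)" .
  note res = enn2real_dist_le[OF 1 2 fin[unfolded h_eq d_eq]]
  show "(\<integral>\<^sup>+ z. indicator (A - G) z * ennreal (f z) \<partial>lborel) < \<infinity>" by (rule res(1))
  show "\<bar>enn2real (\<integral>\<^sup>+ z. indicator (A - G) z * ennreal (f z) \<partial>lborel) - enn2real (proj_mass G h A)\<bar> \<le>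
     enn2real (boundary_error G f h r)"
    unfolding h_eq d_eq by (rule res(2))
qed

text \<open>Two errors add up: passing from \<open>f\<close> to \<open>h\<close> at the foot point
  costs the boundary error, passing from the projected mass to the ray mass costs
  \<open>K * e\<close>. The layer has width \<open>e * T\<close>, so the assumed limit is used along
  \<open>e * T\<close>, at the price of a factor \<open>T\<close>.\<close>

lemma one_sided_limit:
  fixes f h :: "'a \<Rightarrow> real" and A :: "real \<Rightarrow> 'a set"
  assumes f: "f \<in> borel_measurable borel" "\<And>z. 0 \<le> f z" and h: "h \<in> borel_measurable borel"
    and hC: "\<And>xu. xu \<in> Nor G \<Longrightarrow> 0 \<le> h (fst xu) \<and> h (fst xu) \<le> C"
    and hint: "\<And>i. i < DIM('a) \<Longrightarrow> (\<integral>\<^sup>+ xu. ennreal (h (fst xu)) \<partial>Tp i) < \<infinity> \<and>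
        (\<integral>\<^sup>+ xu. ennreal (h (fst xu)) \<partial>Tm i) < \<infinity>"
    and lim: "((\<lambda>e. boundary_error G f h e / ennreal e) \<longlongrightarrow> 0) (at_right 0)"
    and T: "0 < T"
    and A: "\<And>e. 0 < e \<Longrightarrow> e \<le> 1 \<Longrightarrow> A e \<in> sets borel \<and> bounded (A e) \<and> A e - G \<subseteq> {z. infdist z G \<le> e * T}"
  defines "\<Phi> \<equiv> \<lambda>e. ray_mass G (Tp (DIM('a) - 1)) h e (A e)"
    and "Y \<equiv> \<lambda>e. \<integral>\<^sup>+ z. indicator (A e - G) z * ennreal (f z) \<partial>lborel"
  shows "\<forall>\<^sub>F e in at_right 0. \<Phi> e < \<infinity> \<and> Y e < \<infinity>"
    "((\<lambda>e. enn2real (Y e) / e - enn2real (\<Phi> e)) \<longlongrightarrow> 0) (at_right 0)"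
proof -
  define X where "X e = proj_mass G h (A e)" for e
  define D where "D e = boundary_error G f h e" for e
  obtain K where K: "\<And>e A. 0 < e \<and> e \<le> 1 \<and> A \<in> sets borel \<and> bounded A \<and> A - G \<subseteq> {z. infdist z G \<le> e * T} \<Longrightarrow>
    ray_mass G (Tp (DIM('a) - 1)) h e A < \<infinity> \<and> proj_mass G h A < \<infinity> \<and>
    \<bar>enn2real (proj_mass G h A) / e - enn2real (ray_mass G (Tp (DIM('a) - 1)) h e A)\<bar> \<le> K * e"
    using ray_expansion[OF h hC hint T] by auto
  have K': "\<Phi> e < \<infinity>" "X e < \<infinity>" "\<bar>enn2real (X e) / e - enn2real (\<Phi> e)\<bar> \<le> K * e" if "0 < e" "e \<le> 1" for e
    using K[of e "A e"] A[OF that] that unfolding \<Phi>_def X_def by blast+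
  have scale: "filterlim (\<lambda>e. e * T) (at_right 0) (at_right 0)"
    unfolding filterlim_at
    using T by (auto simp: eventually_at_filter intro!: tendsto_eq_intros)
  have limD: "((\<lambda>e. D (e * T) / ennreal (e * T)) \<longlongrightarrow> 0) (at_right 0)"
    using filterlim_compose[OF lim scale] unfolding D_def .
  have ev01: "\<forall>\<^sub>F e in at_right (0::real). 0 < e \<and> e \<le> 1"
    by (auto simp: eventually_at_right_field intro!: exI[of _ 1])
  have "\<forall>\<^sub>F e in at_right 0. D (e * T) / ennreal (e * T) < 1"
    by (rule order_tendstoD(2)[OF limD]) simp
  \<comment> \<open>An infinite integral would make the quotient infinite, while the limit keeps it
    eventually below 1.\<close>
  then have finD: "\<forall>\<^sub>F e in at_right 0. D (e * T) < \<infinity>"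
    using ev01
  proof eventually_elim
    case (elim e)
    have "D (e * T) \<noteq> \<infinity>"
    proof
      assume "D (e * T) = \<infinity>"
      with elim show False by (simp add: ennreal_top_divide)
    qed
    then show ?case by (simp add: less_top[symmetric])
  qed
  have main: "\<forall>\<^sub>F e in at_right 0. Y e < \<infinity> \<and>
      \<bar>enn2real (Y e) / e - enn2real (\<Phi> e)\<bar> \<le> T * enn2real (D (e * T) / ennreal (e * T)) + K * e"
    using ev01 finD
  proof eventually_elim
    case (elim e)
    have Ae: "A e \<in> sets borel" "A e - G \<subseteq> {z. infdist z G \<le> e * T}" using A[of e] elim by auto
    have fin: "proj_mass G h (A e) < \<infinity>" "boundary_error G f h (e * T) < \<infinity>"
      using elim K'(2)[of e] by (simp_all add: X_def D_def)
    note cmp = density_compare[OF f h conjunct1[OF hC] Ae fin]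
    have Y: "Y e < \<infinity>" unfolding Y_def by (rule cmp(1))
    have "\<bar>enn2real (Y e) - enn2real (X e)\<bar> \<le> enn2real (D (e * T))"
      unfolding Y_def X_def D_def by (rule cmp(2))
    then have "\<bar>enn2real (Y e) / e - enn2real (X e) / e\<bar> \<le> enn2real (D (e * T)) / e"
      using elim by (simp add: diff_divide_distrib[symmetric] abs_divide divide_right_mono)
    also have "\<dots> = T * enn2real (D (e * T) / ennreal (e * T))"
    proof -
      have "D (e * T) = ennreal (enn2real (D (e * T)))" using elim by simp
      then have "D (e * T) / ennreal (e * T) = ennreal (enn2real (D (e * T)) / (e * T))"
        using elim T by (metis divide_ennreal enn2real_nonneg mult_pos_pos)
      then have "enn2real (D (e * T) / ennreal (e * T)) = enn2real (D (e * T)) / (e * T)"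
        using elim T by simp
      then show ?thesis using elim T by simp
    qed
    finally show ?case using Y K'(3)[of e] elim by linarith
  qed
  show "\<forall>\<^sub>F e in at_right 0. \<Phi> e < \<infinity> \<and> Y e < \<infinity>"
    using main ev01 by eventually_elim (use K' in blast)
  have "((\<lambda>e. enn2real (D (e * T) / ennreal (e * T))) \<longlongrightarrow> enn2real 0) (at_right 0)"
    using limD by (intro tendsto_enn2real) (simp_all add: zero_ennreal.rep_eq)
  then have "((\<lambda>e. T * enn2real (D (e * T) / ennreal (e * T)) + K * e) \<longlongrightarrow> T * enn2real 0 + K * 0) (at_right 0)"
    by (intro tendsto_add tendsto_mult tendsto_const tendsto_ident_at)
  then have lim0: "((\<lambda>e. T * enn2real (D (e * T) / ennreal (e * T)) + K * e) \<longlongrightarrow> 0) (at_right 0)"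
    by (simp only: enn2real_0 mult_zero_right add_0_right)
  show "((\<lambda>e. enn2real (Y e) / e - enn2real (\<Phi> e)) \<longlongrightarrow> 0) (at_right 0)"
  proof (rule Lim_null_comparison[OF _ lim0])
    show "\<forall>\<^sub>F e in at_right 0. norm (enn2real (Y e) / e - enn2real (\<Phi> e)) \<le>
        T * enn2real (D (e * T) / ennreal (e * T)) + K * e"
      using main by eventually_elim simp
  qed
qed

end

section \<open>The extended top support measure\<close>

lemma Rfl_Rfl [simp]: "Rfl (Rfl xu) = xu"
  by (simp add: Rfl_def)

lemma Rfl_image_eq: "Rfl ` S = Rfl -` S"
proof (intro equalityI subsetI)
  fix xu assume "xu \<in> Rfl -` S"
  then show "xu \<in> Rfl ` S" by (intro image_eqI[of _ _ "Rfl xu"]) auto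
qed auto

lemma Rfl_measurable [measurable]: "Rfl \<in> (borel :: ('a::euclidean_space \<times> 'a) measure) \<rightarrow>\<^sub>M borel"
  unfolding Rfl_def[abs_def] by (intro borel_measurable_continuous_onI continuous_intros)

locale solid_support_measures =
  fixes F :: "'a::euclidean_space set" and Tp Tm Tps Tms :: "nat \<Rightarrow> ('a \<times> 'a) measure"
    and Te :: "('a \<times> 'a) measure"
  assumes solid: "solid F" and F_ne: "F \<noteq> {}"
    and supp_F: "support_measures F Tp Tm"
    and supp_Fs: "support_measures (co F) Tps Tms"
    and ext: "ext_top_measure F Tp Tps Te"
begin

lemma F_closed: "closed F" and F_compact: "compact F"
  using solid by (auto simp: solid_def compact_imp_closed)

lemma F_ne_UNIV: "F \<noteq> UNIV"
  using F_compact compact_imp_bounded not_bounded_UNIV by blast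

lemma coF: "closed (co F)" "co F \<noteq> {}"
  using F_ne_UNIV closure_subset[of "- F"] by (auto simp: co_def)

sublocale outer: support_measure_pair F Tp Tm
  using F_closed F_ne supp_F by unfold_locales

sublocale inner: support_measure_pair "co F" Tps Tms
  using coF supp_Fs by unfold_locales

lemma frontier_eq: "frontier F = F \<inter> co F"
  using F_closed by (simp add: frontier_closures co_def)

lemma frontier_co: "frontier (co F) \<subseteq> frontier F"
  using frontier_closures[of "co F"] closure_mono[of "- co F" F] F_closed coF(1) interior_subset[of F]
  unfolding frontier_eq by (auto simp: co_eq)

lemma Nor_e_iff: "(x, u) \<in> Nor_e F \<longleftrightarrow> (x, u) \<in> Nor F \<or> (x, - u) \<in> Nor (co F)"
  unfolding Nor_e_def Rfl_image_eq by (simp add: Rfl_def)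

lemma Nor_e_frontier:
  assumes "(x, u) \<in> Nor_e F"
  shows "x \<in> frontier F"
  using assms Nor_subset_frontier[OF F_closed F_ne] Nor_subset_frontier[OF coF] frontier_co
  unfolding Nor_e_iff by blast

lemma sets_Te [measurable_cong]: "sets Te = sets borel"
  and AE_Te: "AE xu in Te. xu \<in> Nor_e F"
  and Te_Nor: "A \<in> sets borel \<Longrightarrow> A \<subseteq> Nor F \<Longrightarrow> emeasure Te A = emeasure (Tp (DIM('a) - 1)) A"
  and Te_Rfl: "A \<in> sets borel \<Longrightarrow> A \<subseteq> Rfl ` Nor (co F) \<Longrightarrow> emeasure Te A = emeasure (Tps (DIM('a) - 1)) (Rfl ` A)"
  using ext unfolding ext_top_measure_def by blast+

lemma top_less: "DIM('a) - 1 < DIM('a)"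
  by simp

lemma nn_integral_Te_Nor:
  assumes g: "g \<in> borel_measurable borel" "\<And>xu. xu \<notin> Nor F \<Longrightarrow> g xu = 0"
  shows "(\<integral>\<^sup>+ xu. g xu \<partial>Te) = (\<integral>\<^sup>+ xu. g xu \<partial>Tp (DIM('a) - 1))"
proof -
  have eq: "g xu = indicator (Nor F) xu * g xu" for xu using g(2) by (simp add: indicator_def)
  have "(\<integral>\<^sup>+ xu. indicator (Nor F) xu * g xu \<partial>Te) = (\<integral>\<^sup>+ xu. indicator (Nor F) xu * g xu \<partial>Tp (DIM('a) - 1))"
  proof (rule nn_integral_indicator_cong_measure)
    show "sets Te = sets (Tp (DIM('a) - 1))" using sets_Te outer.sets_Tp[OF top_less] by simp
    show "g \<in> borel_measurable Te" using g(1) by (simp only: measurable_cong_sets[OF sets_Te refl])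
  qed (use sets_Te Te_Nor Nor_measurable[OF F_closed F_ne] in auto)
  then show ?thesis by (simp only: eq[symmetric])
qed

text \<open>On the reflected sheet \<open>Te\<close> is the image measure of the top support measure
  of \<open>co F\<close> under \<open>Rfl\<close>. Since \<open>Rfl\<close> is an involution, images
  and preimages coincide and a change of variables gives the claim.\<close>

lemma nn_integral_Te_Rfl:
  assumes g: "g \<in> borel_measurable borel" "\<And>xu. xu \<notin> Nor (co F) \<Longrightarrow> g xu = 0"
  shows "(\<integral>\<^sup>+ xu. g (Rfl xu) \<partial>Te) = (\<integral>\<^sup>+ xu. g xu \<partial>Tps (DIM('a) - 1))"
proof -
  let ?S = "Rfl ` Nor (co F)" and ?T = "Tps (DIM('a) - 1)"
  have sT: "sets ?T = sets borel" by (rule inner.sets_Tp[OF top_less])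
  have Rm: "Rfl \<in> ?T \<rightarrow>\<^sub>M borel" using Rfl_measurable by (simp only: measurable_cong_sets[OF sT refl])
  have S: "?S \<in> sets borel"
    using measurable_sets[OF Rfl_measurable Nor_measurable[OF coF]] by (simp add: Rfl_image_eq)
  have gR: "(\<lambda>xu. g (Rfl xu)) \<in> borel_measurable borel" by (rule measurable_compose[OF Rfl_measurable g(1)])
  have eq: "g (Rfl xu) = indicator ?S xu * g (Rfl xu)" for xu
    using g(2)[of "Rfl xu"] by (auto simp: Rfl_image_eq indicator_def)
  have "(\<integral>\<^sup>+ xu. indicator ?S xu * g (Rfl xu) \<partial>Te) = (\<integral>\<^sup>+ xu. indicator ?S xu * g (Rfl xu) \<partial>distr ?T borel Rfl)"
  proof (rule nn_integral_indicator_cong_measure)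
    show "(\<lambda>xu. g (Rfl xu)) \<in> borel_measurable Te" using gR by (simp only: measurable_cong_sets[OF sets_Te refl])
    show "emeasure Te A = emeasure (distr ?T borel Rfl) A" if "A \<in> sets Te" "A \<subseteq> ?S" for A
    proof -
      have A: "A \<in> sets borel" using that sets_Te by simp
      have sp: "space ?T = UNIV" using sets_eq_imp_space_eq[OF sT] by simp
      show ?thesis unfolding Te_Rfl[OF A that(2)] emeasure_distr[OF Rm A] Rfl_image_eq by (simp only: sp Int_UNIV_right)
    qed
  qed (use sets_Te S in auto)
  also have "\<dots> = (\<integral>\<^sup>+ xu. g (Rfl xu) \<partial>distr ?T borel Rfl)" by (simp only: eq[symmetric])
  also have "\<dots> = (\<integral>\<^sup>+ xu. g (Rfl (Rfl xu)) \<partial>?T)" by (rule nn_integral_distr[OF Rm]) (use gR in simp)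
  finally show ?thesis by (simp only: eq[symmetric] Rfl_Rfl)
qed

text \<open>On each sheet the pieces with bounded foot points and reach bounded below have finite
  mass; with the null complement of \<open>Nor_e F\<close> they exhaust the space.\<close>

lemma sigma_finite_Te: "sigma_finite_measure Te"
proof
  define P where "P n = {xu \<in> Nor F. norm (fst xu) \<le> real n \<and> ereal (inverse (real (Suc n))) \<le> reach F (fst xu) (snd xu)}" for n
  define Q where "Q n = {xu \<in> Nor (co F). norm (fst xu) \<le> real n \<and> ereal (inverse (real (Suc n))) \<le> reach (co F) (fst xu) (snd xu)}" for n
  have pos: "0 < inverse (real (Suc n))" for n by simp
  have P: "P n \<in> sets borel" "emeasure (Tp (DIM('a) - 1)) (P n) < \<infinity>" for n
    unfolding P_def by (rule outer.level_set_finite[OF pos])+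
  have Q: "Q n \<in> sets borel" "emeasure (Tps (DIM('a) - 1)) (Q n) < \<infinity>" for n
    unfolding Q_def by (rule inner.level_set_finite[OF pos])+
  have RQ: "Rfl ` Q n \<in> sets borel" for n
    using measurable_sets[OF Rfl_measurable Q(1)[of n]] by (simp add: Rfl_image_eq)
  have RRQ: "Rfl ` Rfl ` Q n = Q n" for n by (simp add: image_image)
  have N: "Nor_e F = (\<Union>n. P n) \<union> (\<Union>n. Rfl ` Q n)"
    unfolding Nor_e_def P_def Q_def using outer.Nor_eq_UN_level_sets inner.Nor_eq_UN_level_sets
    by (metis image_UN)
  have N_sets: "Nor_e F \<in> sets borel" unfolding N using P(1) RQ by auto
  have sp: "space Te = UNIV" using sets_eq_imp_space_eq[OF sets_Te] by simp
  have "emeasure Te (- Nor_e F) = 0"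
  proof -
    have *: "{xu \<in> space Te. xu \<notin> Nor_e F} = - Nor_e F" by (auto simp: sp)
    have "- Nor_e F \<in> sets Te" using N_sets sets_Te by auto
    then show ?thesis
      using AE_Te AE_iff_null[of Te "\<lambda>xu. xu \<in> Nor_e F"] unfolding * by auto
  qed
  moreover have "emeasure Te (P n) < \<infinity>" for n
    using Te_Nor[OF P(1)] P(2)[of n] by (simp add: P_def)
  moreover have "emeasure Te (Rfl ` Q n) < \<infinity>" for n
  proof -
    have "Rfl ` Q n \<subseteq> Rfl ` Nor (co F)" by (auto simp: Q_def)
    then show ?thesis using Te_Rfl[OF RQ] Q(2)[of n] by (simp add: RRQ)
  qed
  ultimately show "\<exists>A. countable A \<and> A \<subseteq> sets Te \<and> \<Union> A = space Te \<and> (\<forall>a\<in>A. emeasure Te a \<noteq> \<infinity>)"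
    by (intro exI[of _ "insert (- Nor_e F) (range P \<union> range (\<lambda>n. Rfl ` Q n))"])
      (use P(1) RQ N_sets in \<open>auto simp: sp sets_Te N less_top\<close>)
qed

lemma pair_Te: "pair_sigma_finite (lborel :: real measure) Te"
proof -
  interpret T: sigma_finite_measure Te by (rule sigma_finite_Te)
  show ?thesis ..
qed

lemma sets_M: "sets ((lborel :: real measure) \<Otimes>\<^sub>M Te) = sets borel"
proof -
  have "sets ((lborel :: real measure) \<Otimes>\<^sub>M Te) = sets ((borel :: real measure) \<Otimes>\<^sub>M (borel :: ('a \<times> 'a) measure))"
    by (rule sets_pair_measure_cong) (simp_all add: sets_Te)
  then show ?thesis by (simp only: borel_prod)
qed

lemma ray_set_neg_measurable:
  assumes "A \<in> sets borel"
  shows "ray_set_neg F e A \<in> sets borel"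
proof -
  have "(\<lambda>p :: real \<times> 'a \<times> 'a. (- fst p, fst (snd p), - snd (snd p))) \<in> borel_measurable borel"
    by (intro borel_measurable_continuous_onI continuous_intros)
  from measurable_sets[OF this ray_set_measurable[OF coF assms]]
  show ?thesis by (simp add: ray_set_neg_def vimage_def split_beta')
qed

text \<open>After Fubini the sections vanish off the relevant sheet, so \<open>Te\<close> may be
  exchanged for the support measure of that side. On the inner side, reversing the height preserves
  Lebesgue measure, and reflecting the normal leaves \<open>h\<close> unchanged because it sees only
  the foot point.\<close>

lemma nn_integral_ray_set:
  assumes A: "A \<in> sets borel" and h: "h \<in> borel_measurable borel"
  shows "(\<integral>\<^sup>+ p. indicator (ray_set F e A) p * ennreal (h (fst (snd p))) \<partial>(lborel \<Otimes>\<^sub>M Te)) =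
    ray_mass F (Tp (DIM('a) - 1)) h e A" (is ?outer)
    and "(\<integral>\<^sup>+ p. indicator (ray_set_neg F e A) p * ennreal (h (fst (snd p))) \<partial>(lborel \<Otimes>\<^sub>M Te)) =
    ray_mass (co F) (Tps (DIM('a) - 1)) h e A" (is ?inner)
proof -
  interpret pair_sigma_finite "lborel :: real measure" Te by (rule pair_Te)
  have hm: "(\<lambda>p :: real \<times> 'a \<times> 'a. ennreal (h (fst (snd p)))) \<in> borel_measurable borel"
    by (intro measurable_compose[OF _ measurable_ennreal] measurable_compose[OF _ h]
        borel_measurable_continuous_onI continuous_intros)
  have gm: "(\<lambda>p. indicator W p * ennreal (h (fst (snd p)))) \<in> borel_measurable borel"
    if "W \<in> sets borel" for W :: "(real \<times> 'a \<times> 'a) set"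
    using that hm by (intro borel_measurable_times_ennreal borel_measurable_indicator)
  have sec: "(\<lambda>xu. \<integral>\<^sup>+ s. indicator W (s, xu) * ennreal (h (fst xu)) \<partial>lborel) \<in> borel_measurable borel"
    if W: "W \<in> sets borel" for W :: "(real \<times> 'a \<times> 'a) set"
  proof -
    have "(\<lambda>p. (\<lambda>p. indicator W p * ennreal (h (fst (snd p)))) (snd p, fst p)) \<in>
       borel_measurable ((borel :: ('a \<times> 'a) measure) \<Otimes>\<^sub>M (lborel :: real measure))"
    proof (rule measurable_compose[OF _ gm[OF W]])
      show "(\<lambda>p. (snd p, fst p)) \<in> (borel :: ('a \<times> 'a) measure) \<Otimes>\<^sub>M (lborel :: real measure) \<rightarrow>\<^sub>M borel"
        unfolding borel_prod[symmetric] by measurable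
    qed
    then have "(\<lambda>(xu, s). indicator W (s, xu) * ennreal (h (fst xu))) \<in>
       borel_measurable ((borel :: ('a \<times> 'a) measure) \<Otimes>\<^sub>M (lborel :: real measure))"
      by (simp add: split_beta')
    then show ?thesis by (rule lborel.borel_measurable_nn_integral)
  qed
  have fub: "(\<integral>\<^sup>+ p. indicator W p * ennreal (h (fst (snd p))) \<partial>(lborel \<Otimes>\<^sub>M Te)) =
      (\<integral>\<^sup>+ xu. \<integral>\<^sup>+ s. indicator W (s, xu) * ennreal (h (fst xu)) \<partial>lborel \<partial>Te)"
    if W: "W \<in> sets borel" for W :: "(real \<times> 'a \<times> 'a) set"
    using nn_integral_snd[of "\<lambda>p. indicator W p * ennreal (h (fst (snd p)))"] gm[OF W]
    by (simp add: measurable_cong_sets[OF sets_M refl])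
  have Wo: "ray_set F e A \<in> sets borel" by (rule ray_set_measurable[OF F_closed F_ne A])
  have Wi: "ray_set (co F) e A \<in> sets borel" by (rule ray_set_measurable[OF coF A])
  show ?outer unfolding fub[OF Wo] ray_mass_def
  proof (rule nn_integral_Te_Nor[OF sec[OF Wo]])
    fix xu assume "xu \<notin> Nor F"
    then show "(\<integral>\<^sup>+ s. indicator (ray_set F e A) (s, xu) * ennreal (h (fst xu)) \<partial>lborel) = 0"
      by (simp add: ray_set_def indicator_def)
  qed
  have "(\<integral>\<^sup>+ s. indicator (ray_set_neg F e A) (s, xu) * ennreal (h (fst xu)) \<partial>lborel) =
     (\<integral>\<^sup>+ s. indicator (ray_set (co F) e A) (s, Rfl xu) * ennreal (h (fst (Rfl xu))) \<partial>lborel)" for xu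
  proof -
    have m: "(\<lambda>s. indicator (ray_set (co F) e A) (s, Rfl xu) * ennreal (h (fst (Rfl xu)))) \<in> borel_measurable borel"
    proof (intro borel_measurable_times_ennreal borel_measurable_const)
      have "(\<lambda>s::real. (s, Rfl xu)) \<in> borel_measurable borel"
        by (intro borel_measurable_continuous_onI continuous_intros)
      then show "(\<lambda>s. indicator (ray_set (co F) e A) (s, Rfl xu) :: ennreal) \<in> borel_measurable borel"
        by (rule measurable_compose[OF _ borel_measurable_indicator[OF Wi]])
    qed
    have "(\<integral>\<^sup>+ s. indicator (ray_set (co F) e A) (s, Rfl xu) * ennreal (h (fst (Rfl xu))) \<partial>lborel) =
      (\<integral>\<^sup>+ s. indicator (ray_set (co F) e A) (- s, Rfl xu) * ennreal (h (fst (Rfl xu))) \<partial>lborel)"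
      using nn_integral_real_affine[OF m, of "- 1" 0] by simp
    also have "\<dots> = (\<integral>\<^sup>+ s. indicator (ray_set_neg F e A) (s, xu) * ennreal (h (fst xu)) \<partial>lborel)"
      by (intro nn_integral_cong) (simp add: ray_set_neg_def Rfl_def indicator_def split_beta')
    finally show ?thesis by simp
  qed
  then show ?inner unfolding fub[OF ray_set_neg_measurable[OF A]] ray_mass_def
    using nn_integral_Te_Rfl[OF sec[OF Wi]] by (simp add: ray_set_def)
qed

text \<open>Any measurable cover of the symmetric difference of the magnified set and
  \<open>B\<close>, enlarged by the two null graphs, covers that of \<open>W\<close> and
  \<open>B\<close>. The infimum over covers gives the bound.\<close>

lemma magnified_symdiff_le:
  assumes A: "A \<in> sets borel" and e: "0 < e" and B: "B \<in> sets borel" "B \<subseteq> Sigma_cyl F"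
  defines "W \<equiv> ray_set F e A \<union> ray_set_neg F e A"
  shows "emeasure (lborel \<Otimes>\<^sub>M Te) ((W - B) \<union> (B - W)) \<le>
    outer_measure_of (lborel \<Otimes>\<^sub>M Te) ((tau_img F e A - B) \<union> (B - tau_img F e A))"
proof -
  define N where "N = {p :: real \<times> 'a \<times> 'a. ereal (e * fst p) = reach F (fst (snd p)) (snd (snd p))} \<union>
       {p. ereal (- e * fst p) = reach (co F) (fst (snd p)) (- snd (snd p))}"
  have "(\<lambda>xu. reach (co F) (fst (Rfl xu)) (snd (Rfl xu))) \<in> borel_measurable borel"
    by (rule measurable_compose[OF Rfl_measurable reach_measurable[OF coF]])
  then have r2: "(\<lambda>xu. reach (co F) (fst xu) (- snd xu)) \<in> borel_measurable borel"
    by (simp add: Rfl_def)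
  have N: "N \<in> null_sets (lborel \<Otimes>\<^sub>M Te)"
    unfolding N_def
    using null_sets_graph[OF sigma_finite_Te sets_Te reach_measurable[OF F_closed F_ne], of e]
      null_sets_graph[OF sigma_finite_Te sets_Te r2, of "- e"] e
    by (intro null_sets.Un) auto
  have tau: "W \<subseteq> tau_img F e A" "tau_img F e A \<subseteq> W \<union> N"
    unfolding W_def N_def using tau_img_bounds(1,2)[OF F_closed F_ne coF(2) e] by blast+
  have W: "W \<in> sets borel"
    unfolding W_def using ray_set_measurable[OF F_closed F_ne A] ray_set_neg_measurable[OF A] by auto
  show ?thesis
    unfolding outer_measure_of_def
  proof (rule INF_greatest)
    fix E assume "E \<in> {C \<in> sets (lborel \<Otimes>\<^sub>M Te). (tau_img F e A - B) \<union> (B - tau_img F e A) \<subseteq> C}"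
    then have E: "E \<in> sets (lborel \<Otimes>\<^sub>M Te)" "(tau_img F e A - B) \<union> (B - tau_img F e A) \<subseteq> E" by auto
    have "emeasure (lborel \<Otimes>\<^sub>M Te) ((W - B) \<union> (B - W)) \<le> emeasure (lborel \<Otimes>\<^sub>M Te) (E \<union> N)"
      using tau E N by (intro emeasure_mono) auto
    also have "\<dots> = emeasure (lborel \<Otimes>\<^sub>M Te) E"
      by (rule emeasure_Un_null_set[OF E(1) N])
    finally show "emeasure (lborel \<Otimes>\<^sub>M Te) ((W - B) \<union> (B - W)) \<le> emeasure (lborel \<Otimes>\<^sub>M Te) E" .
  qed
qed

end

section \<open>Differentiation of the measure\<close>

theorem theorem4:
  fixes F :: "'a::euclidean_space set"
    and f fp fm :: "'a \<Rightarrow> real"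
    and Tp Tm Tps Tms :: "nat \<Rightarrow> ('a \<times> 'a) measure"
    and Te :: "('a \<times> 'a) measure"
    and T :: real
    and A :: "real \<Rightarrow> 'a set"
    and B :: "(real \<times> 'a \<times> 'a) set"
  assumes solid: "solid F" and F_ne: "F \<noteq> {}"
    and supp_F: "support_measures F Tp Tm"
    and supp_Fs: "support_measures (co F) Tps Tms"
    and ext: "ext_top_measure F Tp Tps Te"
    and f_meas: "f \<in> borel_measurable borel" and f_nonneg: "\<And>z. f z \<ge> 0"
    and fp_meas: "fp \<in> borel_measurable borel" and fp_nonneg: "\<And>x. x \<in> frontier F \<Longrightarrow> fp x \<ge> 0"
    and fp_bdd: "bounded (fp ` frontier F)"
    and fm_meas: "fm \<in> borel_measurable borel" and fm_nonneg: "\<And>x. x \<in> frontier F \<Longrightarrow> fm x \<ge> 0"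
    and fm_bdd: "bounded (fm ` frontier F)"
    and lim_out: "((\<lambda>e. (\<integral>\<^sup>+ z. indicator {z. 0 < dist_set F z \<and> dist_set F z \<le> e} z *
                          ennreal \<bar>f z - fp (proj F z)\<bar> \<partial>lborel) / ennreal e) \<longlongrightarrow> 0) (at_right 0)"
    and lim_in: "((\<lambda>e. (\<integral>\<^sup>+ z. indicator {z. 0 < dist_set (co F) z \<and> dist_set (co F) z \<le> e} z *
                          ennreal \<bar>f z - fm (proj (co F) z)\<bar> \<partial>lborel) / ennreal e) \<longlongrightarrow> 0) (at_right 0)"
    and int_p: "\<And>i. i < DIM('a) \<Longrightarrow>
        (\<integral>\<^sup>+ xu. ennreal (fp (fst xu)) \<partial>Tp i) < \<infinity> \<and> (\<integral>\<^sup>+ xu. ennreal (fp (fst xu)) \<partial>Tm i) < \<infinity> \<and>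
        (\<integral>\<^sup>+ xu. ennreal (fp (fst xu)) \<partial>Tps i) < \<infinity> \<and> (\<integral>\<^sup>+ xu. ennreal (fp (fst xu)) \<partial>Tms i) < \<infinity>"
    and int_m: "\<And>i. i < DIM('a) \<Longrightarrow>
        (\<integral>\<^sup>+ xu. ennreal (fm (fst xu)) \<partial>Tp i) < \<infinity> \<and> (\<integral>\<^sup>+ xu. ennreal (fm (fst xu)) \<partial>Tm i) < \<infinity> \<and>
        (\<integral>\<^sup>+ xu. ennreal (fm (fst xu)) \<partial>Tps i) < \<infinity> \<and> (\<integral>\<^sup>+ xu. ennreal (fm (fst xu)) \<partial>Tms i) < \<infinity>"
    and T_pos: "T > 0"
    and A_borel: "\<And>e. e \<in> {0..1} \<Longrightarrow> A e \<in> sets borel"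
    and A0: "A 0 \<subseteq> frontier F"
    and A_sub: "\<And>e. e \<in> {0..1} \<Longrightarrow> A e \<subseteq> parset (frontier F) (e * T)"
    and diff: "differentiable_at_bd F Te A B"
    and B_sub: "B \<subseteq> Sigma_T F T"
  shows "((\<lambda>e. (measure (density lborel (\<lambda>z. ennreal (f z))) (A e)
                 - measure (density lborel (\<lambda>z. ennreal (f z))) (A 0)) / e)
           \<longlongrightarrow> measure (density (lborel \<Otimes>\<^sub>M Te)
                   (\<lambda>sxu. ennreal (if fst sxu \<ge> 0 then fp (fst (snd sxu)) else fm (fst (snd sxu))))) B)
         (at_right 0)"
proof -
  interpret S: solid_support_measures F Tp Tm Tps Tms Te
    by unfold_locales (fact solid F_ne supp_F supp_Fs ext)+
  define M where "M = (lborel :: real measure) \<Otimes>\<^sub>M Te"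
  define q where "q p = ennreal (if fst p \<ge> 0 then fp (fst (snd p)) else fm (fst (snd p)))" for p :: "real \<times> 'a \<times> 'a"
  define W where "W e = ray_set F e (A e) \<union> ray_set_neg F e (A e)" for e
  define \<Phi>p where "\<Phi>p e = ray_mass F (Tp (DIM('a) - 1)) fp e (A e)" for e
  define \<Phi>m where "\<Phi>m e = ray_mass (co F) (Tps (DIM('a) - 1)) fm e (A e)" for e
  define Yp where "Yp e = (\<integral>\<^sup>+ z. indicator (A e - F) z * ennreal (f z) \<partial>lborel)" for e
  define Ym where "Ym e = (\<integral>\<^sup>+ z. indicator (A e - co F) z * ennreal (f z) \<partial>lborel)" for e
  define \<mu> where "\<mu> = measure (density lborel (\<lambda>z. ennreal (f z)))"
  define \<delta> where "\<delta> e = emeasure M ((W e - B) \<union> (B - W e))" for e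
  \<comment> \<open>\<open>infdist\<close> to the empty set is 0 by convention, so comparing
    distances to \<open>frontier F\<close> with those to \<open>F\<close> and \<open>co F\<close>
    calls for a nonempty frontier.\<close>
  have fr_ne: "frontier F \<noteq> {}" using F_ne S.F_ne_UNIV by (simp add: frontier_not_empty)
  have ev01: "\<forall>\<^sub>F e in at_right (0::real). 0 < e \<and> e \<le> 1"
    by (auto simp: eventually_at_right_field intro!: exI[of _ 1])
  have B: "B \<in> sets borel" "B \<subseteq> Sigma_cyl F"
    and lim_tau: "((\<lambda>e. outer_measure_of M ((tau_img F e (A e) - B) \<union> (B - tau_img F e (A e)))) \<longlongrightarrow> 0) (at_right 0)"
    and A_bdd: "\<And>e. e \<in> {0..1} \<Longrightarrow> bounded (A e)"
    using diff unfolding differentiable_at_bd_def ess_bounded_def M_def by blast+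
  obtain C1 where C1: "\<And>x. x \<in> frontier F \<Longrightarrow> fp x \<le> C1"
  proof -
    obtain b where "\<forall>y\<in>fp ` frontier F. norm y \<le> b" using fp_bdd unfolding bounded_iff by blast
    then show thesis by (intro that[of b]) (auto simp: abs_le_iff)
  qed
  obtain C2 where C2: "\<And>x. x \<in> frontier F \<Longrightarrow> fm x \<le> C2"
  proof -
    obtain b where "\<forall>y\<in>fm ` frontier F. norm y \<le> b" using fm_bdd unfolding bounded_iff by blast
    then show thesis by (intro that[of b]) (auto simp: abs_le_iff)
  qed
  \<comment> \<open>The densities are bounded on the frontier only. The constant is usable because
    \<open>W e\<close> and \<open>B\<close> lie over \<open>Nor_e F\<close>, whose foot points are
    on the frontier.\<close>
  define C where "C = max C1 C2"
  have A_near: "A e - F \<subseteq> {z. infdist z F \<le> e * T}" "A e - co F \<subseteq> {z. infdist z (co F) \<le> e * T}"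
    if "e \<in> {0..1}" for e
  proof -
    have "infdist z F \<le> infdist z (frontier F)" "infdist z (co F) \<le> infdist z (frontier F)" for z
      using fr_ne by (auto intro!: infdist_mono simp: S.frontier_eq)
    then show "A e - F \<subseteq> {z. infdist z F \<le> e * T}" "A e - co F \<subseteq> {z. infdist z (co F) \<le> e * T}"
      using A_sub[OF that] order_trans unfolding parset_def dist_set_def by blast+
  qed
  have Nor_fp: "0 \<le> fp (fst xu) \<and> fp (fst xu) \<le> C" if "xu \<in> Nor F" for xu
  proof -
    have "fst xu \<in> frontier F" using Nor_subset_frontier[OF S.F_closed F_ne, of "fst xu" "snd xu"] that by simp
    then show ?thesis using fp_nonneg C1[of "fst xu"] by (auto simp: C_def)
  qed
  have Nor_fm: "0 \<le> fm (fst xu) \<and> fm (fst xu) \<le> C" if "xu \<in> Nor (co F)" for xu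
  proof -
    have "fst xu \<in> frontier F"
      using Nor_subset_frontier[OF S.coF, of "fst xu" "snd xu"] S.frontier_co that by auto
    then show ?thesis using fm_nonneg C2[of "fst xu"] by (auto simp: C_def)
  qed
  have A_ok: "A e \<in> sets borel \<and> bounded (A e) \<and> A e - F \<subseteq> {z. infdist z F \<le> e * T}"
      "A e \<in> sets borel \<and> bounded (A e) \<and> A e - co F \<subseteq> {z. infdist z (co F) \<le> e * T}" if "0 < e" "e \<le> 1" for e
    using A_borel[of e] A_bdd[of e] A_near[of e] that by auto
  have outer: "\<forall>\<^sub>F e in at_right 0. \<Phi>p e < \<infinity> \<and> Yp e < \<infinity>"
      "((\<lambda>e. enn2real (Yp e) / e - enn2real (\<Phi>p e)) \<longlongrightarrow> 0) (at_right 0)"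
    unfolding \<Phi>p_def Yp_def
    using S.outer.one_sided_limit[OF f_meas f_nonneg fp_meas Nor_fp _ lim_out[folded boundary_error_def] T_pos A_ok(1)] int_p
    by blast+
  have inner: "\<forall>\<^sub>F e in at_right 0. \<Phi>m e < \<infinity> \<and> Ym e < \<infinity>"
      "((\<lambda>e. enn2real (Ym e) / e - enn2real (\<Phi>m e)) \<longlongrightarrow> 0) (at_right 0)"
    unfolding \<Phi>m_def Ym_def
    using S.inner.one_sided_limit[OF f_meas f_nonneg fm_meas Nor_fm _ lim_in[folded boundary_error_def] T_pos A_ok(2)] int_m
    by blast+
  have sets_M: "sets M = sets borel" unfolding M_def by (rule S.sets_M)
  have qm: "q \<in> borel_measurable M"
  proof -
    have c: "(\<lambda>p :: real \<times> 'a \<times> 'a. fst (snd p)) \<in> borel_measurable borel" "(fst :: real \<times> 'a \<times> 'a \<Rightarrow> real) \<in> borel_measurable borel"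
      by (intro borel_measurable_continuous_onI continuous_intros)+
    note [measurable] = c(2) measurable_compose[OF c(1) fp_meas] measurable_compose[OF c(1) fm_meas]
    have "q \<in> borel_measurable borel" unfolding q_def[abs_def] by measurable
    then show ?thesis by (simp only: measurable_cong_sets[OF sets_M refl])
  qed
  have Wsets: "ray_set F e (A e) \<in> sets borel" "ray_set_neg F e (A e) \<in> sets borel" "W e \<in> sets M" if "0 < e" "e \<le> 1" for e
    using ray_set_measurable[OF S.F_closed F_ne, of "A e" e] S.ray_set_neg_measurable[of "A e" e] A_borel[of e] that
    by (auto simp: W_def sets_M)
  \<comment> \<open>Outer rays have positive height and inner rays negative height; the two sets are
    disjoint and \<open>q\<close> picks the matching density on each.\<close>
  have mass_W: "(\<integral>\<^sup>+ p. q p * indicator (W e) p \<partial>M) = \<Phi>p e + \<Phi>m e" if e: "0 < e" "e \<le> 1" for e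
  proof -
    have Ae: "A e \<in> sets borel" using A_ok(1)[OF e] by simp
    have cm: "(\<lambda>p :: real \<times> 'a \<times> 'a. ennreal (h (fst (snd p)))) \<in> borel_measurable M"
      if "h \<in> borel_measurable borel" for h
      unfolding measurable_cong_sets[OF sets_M refl]
      by (intro measurable_compose[OF _ measurable_ennreal] measurable_compose[OF _ that]
        borel_measurable_continuous_onI continuous_intros)
    have "(\<integral>\<^sup>+ p. q p * indicator (W e) p \<partial>M) =
      (\<integral>\<^sup>+ p. indicator (ray_set F e (A e)) p * ennreal (fp (fst (snd p))) +
          indicator (ray_set_neg F e (A e)) p * ennreal (fm (fst (snd p))) \<partial>M)"
      by (intro nn_integral_cong) (auto simp: q_def W_def indicator_def ray_set_def ray_set_neg_def)
    also have "\<dots> = (\<integral>\<^sup>+ p. indicator (ray_set F e (A e)) p * ennreal (fp (fst (snd p))) \<partial>M) +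
        (\<integral>\<^sup>+ p. indicator (ray_set_neg F e (A e)) p * ennreal (fm (fst (snd p))) \<partial>M)"
      using Wsets[OF e] cm[OF fp_meas] cm[OF fm_meas] sets_M
      by (intro nn_integral_add borel_measurable_times_ennreal borel_measurable_indicator) auto
    also have "\<dots> = \<Phi>p e + \<Phi>m e"
      unfolding M_def \<Phi>p_def \<Phi>m_def S.nn_integral_ray_set(1)[OF Ae fp_meas] S.nn_integral_ray_set(2)[OF Ae fm_meas] ..
    finally show ?thesis .
  qed
  have q_le: "q (s, x, u) \<le> ennreal C" if "(x, u) \<in> Nor_e F" for s x u
    using C1[OF S.Nor_e_frontier[OF that]] C2[OF S.Nor_e_frontier[OF that]]
    unfolding q_def C_def by (intro ennreal_leI) auto
  have W_sub: "W e \<subseteq> Sigma_cyl F" for e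
    by (auto simp: W_def ray_set_def ray_set_neg_def Sigma_cyl_def S.Nor_e_iff)
  have q_le': "q p \<le> ennreal C" if "p \<in> W e \<or> p \<in> B" for p e
    using that W_sub[of e] B(2) by (cases p) (auto simp: Sigma_cyl_def intro!: q_le)
  have \<delta>_le: "\<delta> e \<le> outer_measure_of M ((tau_img F e (A e) - B) \<union> (B - tau_img F e (A e)))" if "0 < e" "e \<le> 1" for e
    unfolding \<delta>_def W_def M_def using A_ok(1)[OF that] that by (intro S.magnified_symdiff_le B) auto
  have \<delta>_lim: "(\<delta> \<longlongrightarrow> 0) (at_right 0)"
    by (rule tendsto_sandwich[OF _ _ tendsto_const lim_tau])
      (auto intro: eventually_mono[OF ev01] \<delta>_le)
  have \<delta>_fin: "\<forall>\<^sub>F e in at_right 0. \<delta> e < \<infinity>"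
    using order_tendstoD(2)[OF \<delta>_lim, of \<infinity>] by simp
  define Q where "Q = (\<integral>\<^sup>+ p. q p * indicator B p \<partial>M)"
  \<comment> \<open>\<open>Q\<close> is not yet known to be finite, so it plays the part of
    \<open>a\<close> in \<open>enn2real_dist_le\<close>; the ray masses and the error are finite for
    small \<open>e\<close>.\<close>
  have Q_dist: "\<forall>\<^sub>F e in at_right 0. \<bar>enn2real Q - enn2real (\<Phi>p e + \<Phi>m e)\<bar> \<le> enn2real (ennreal C * \<delta> e)"
    using ev01 \<delta>_fin outer(1) inner(1)
  proof eventually_elim
    case (elim e)
    let ?D = "(W e - B) \<union> (B - W e)"
    have Bs: "B \<in> sets M" using B(1) sets_M by simp
    have We: "W e \<in> sets M" using Wsets elim by auto
    have D: "(\<integral>\<^sup>+ p. ennreal C * indicator ?D p \<partial>M) = ennreal C * \<delta> e"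
      unfolding \<delta>_def using Bs We by (intro nn_integral_cmult_indicator) auto
    have add: "(\<integral>\<^sup>+ p. q p * indicator S p + ennreal C * indicator ?D p \<partial>M) =
        (\<integral>\<^sup>+ p. q p * indicator S p \<partial>M) + ennreal C * \<delta> e" if "S \<in> sets M" for S
      unfolding D[symmetric] using that qm Bs We
      by (intro nn_integral_add borel_measurable_times_ennreal borel_measurable_indicator) auto
    have "Q \<le> (\<integral>\<^sup>+ p. q p * indicator (W e) p + ennreal C * indicator ?D p \<partial>M)"
      unfolding Q_def using q_le'[of _ e] by (intro nn_integral_mono) (auto simp: indicator_def)
    then have 1: "Q \<le> (\<Phi>p e + \<Phi>m e) + ennreal C * \<delta> e" using add[OF We] mass_W elim by simp
    have "(\<integral>\<^sup>+ p. q p * indicator (W e) p \<partial>M) \<le> (\<integral>\<^sup>+ p. q p * indicator B p + ennreal C * indicator ?D p \<partial>M)"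
      using q_le'[of _ e] by (intro nn_integral_mono) (auto simp: indicator_def)
    then have 2: "\<Phi>p e + \<Phi>m e \<le> Q + ennreal C * \<delta> e" using add[OF Bs] mass_W elim by (simp add: Q_def)
    show ?case
      by (rule enn2real_dist_le(2)[OF 1 2]) (use elim in \<open>auto simp: ennreal_mult_less_top\<close>)
  qed
  have "((\<lambda>e. ennreal C * \<delta> e) \<longlongrightarrow> ennreal C * 0) (at_right 0)"
    by (rule ennreal_tendsto_cmult[OF _ \<delta>_lim]) simp
  then have "((\<lambda>e. enn2real (ennreal C * \<delta> e)) \<longlongrightarrow> 0) (at_right 0)"
    by (intro tendsto_enn2real) (simp_all add: zero_ennreal_def[symmetric])
  then have lim_Q: "((\<lambda>e. enn2real (\<Phi>p e + \<Phi>m e)) \<longlongrightarrow> enn2real Q) (at_right 0)"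
  proof -
    assume lim0: "((\<lambda>e. enn2real (ennreal C * \<delta> e)) \<longlongrightarrow> 0) (at_right 0)"
    have "((\<lambda>e. enn2real (\<Phi>p e + \<Phi>m e) - enn2real Q) \<longlongrightarrow> 0) (at_right 0)"
    proof (rule Lim_null_comparison[OF _ lim0])
      show "\<forall>\<^sub>F e in at_right 0. norm (enn2real (\<Phi>p e + \<Phi>m e) - enn2real Q) \<le> enn2real (ennreal C * \<delta> e)"
        using Q_dist by eventually_elim (simp add: abs_minus_commute)
    qed
    then show ?thesis by (rule LIM_zero_cancel)
  qed
  have null_fr: "frontier F \<in> null_sets lborel"
    using solid by (simp add: solid_def null_sets_def)
  have \<mu>_eq: "\<mu> X = enn2real (\<integral>\<^sup>+ z. ennreal (f z) * indicator X z \<partial>lborel)" if "X \<in> sets borel" for X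
    unfolding \<mu>_def measure_def using that f_meas by (subst emeasure_density) auto
  \<comment> \<open>Solidity makes the frontier Lebesgue null, and \<open>A 0\<close> lies in
    it.\<close>
  have \<mu>0: "\<mu> (A 0) = 0"
  proof -
    have "(\<integral>\<^sup>+ z. ennreal (f z) * indicator (A 0) z \<partial>lborel) = (\<integral>\<^sup>+ z. 0 \<partial>(lborel :: 'a measure))"
      by (intro nn_integral_cong_AE AE_mp[OF AE_not_in[OF null_fr] AE_I2]) (use A0 in \<open>auto simp: indicator_def\<close>)
    then show ?thesis using \<mu>_eq[of "A 0"] A_borel[of 0] by simp
  qed
  \<comment> \<open>Off the null frontier each point is in exactly one of \<open>F\<close> and
    \<open>co F\<close>, so the two one-sided masses add up to that of \<open>A e\<close>.
    \<open>enn2real\<close> is additive on finite summands, hence the appeal to eventual finiteness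
    on both sides. The difference quotient becomes two vanishing errors plus the convergent ray
    mass.\<close>
  have \<mu>e: "\<forall>\<^sub>F e in at_right 0. (enn2real (Yp e) / e - enn2real (\<Phi>p e)) + (enn2real (Ym e) / e - enn2real (\<Phi>m e)) +
      enn2real (\<Phi>p e + \<Phi>m e) = (\<mu> (A e) - \<mu> (A 0)) / e"
    using ev01 outer(1) inner(1)
  proof eventually_elim
    case (elim e)
    have Ae: "A e \<in> sets borel" using A_ok elim by auto
    have "(\<integral>\<^sup>+ z. ennreal (f z) * indicator (A e) z \<partial>lborel) =
      (\<integral>\<^sup>+ z. indicator (A e - F) z * ennreal (f z) + indicator (A e - co F) z * ennreal (f z) \<partial>lborel)"
    proof (intro nn_integral_cong_AE AE_mp[OF AE_not_in[OF null_fr] AE_I2] impI)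
      fix z assume "z \<notin> frontier F"
      moreover have "z \<in> F \<or> z \<in> co F" using closure_subset[of "- F"] by (auto simp: co_def)
      ultimately show "ennreal (f z) * indicator (A e) z =
          indicator (A e - F) z * ennreal (f z) + indicator (A e - co F) z * ennreal (f z)"
        by (auto simp: S.frontier_eq indicator_def)
    qed
    also have "\<dots> = Yp e + Ym e"
      unfolding Yp_def Ym_def using Ae S.F_closed S.coF(1) f_meas
      by (intro nn_integral_add borel_measurable_times_ennreal borel_measurable_indicator) auto
    finally have "\<mu> (A e) = enn2real (Yp e) + enn2real (Ym e)"
      using elim by (simp add: \<mu>_eq[OF Ae] enn2real_plus)
    moreover have "enn2real (\<Phi>p e + \<Phi>m e) = enn2real (\<Phi>p e) + enn2real (\<Phi>m e)"
      using elim by (simp add: enn2real_plus)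
    ultimately show ?case by (simp add: \<mu>0 add_divide_distrib)
  qed
  have "((\<lambda>e. (\<mu> (A e) - \<mu> (A 0)) / e) \<longlongrightarrow> 0 + 0 + enn2real Q) (at_right 0)"
    by (rule Lim_transform_eventually[OF tendsto_add[OF tendsto_add[OF outer(2) inner(2)] lim_Q] \<mu>e])
  moreover have "measure (density M q) B = enn2real Q"
    unfolding measure_def Q_def using B(1) qm sets_M by (subst emeasure_density) auto
  ultimately show ?thesis
    unfolding \<mu>_def M_def q_def[abs_def] by simp
qed

end
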